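(* Let $\Theta=\mathbb{Z}$ or $\Theta=\mathbb{R}$ and let $(B(t))_{t\in\Theta}$ be a centered complex-valued wide sense stationary process (mean square continuous if $\Theta=\mathbb{R}$), with spectral measure $\mu$ and spectral orthogonal random measure $\mathcal{W}$. Let $\ell$ be an arbitrary measurable complex-valued function (on $[-\pi,\pi)$ if $\Theta=\mathbb{Z}$, on $\mathbb{R}$ if $\Theta=\mathbb{R}$) and let $L$ be the linear filter with frequency characteristic $\ell$. Then the minimization problem $$\mathbb{E}|Y-B(0)|^2+\mathbb{E}|LY|^2\to\min,\qquad Y\in H\cap\mathcal{D}(L),$$ has a unique solution, and it is given by $$\xi=\int\frac{1}{1+|\ell(u)|^2}\,\mathcal{W}(du).$$ The minimum value is $$\sigma^2:=\mathbb{E}|\xi-B(0)|^2+\mathbb{E}|L\xi|^2=\int\frac{|\ell(u)|^2}{1+|\ell(u)|^2}\,\mu(du)=\mathbb{E}|B(0)|^2-\int\frac{\mu(du)}{1+|\ell(u)|^2}.$$ All integrals are over $[-\pi,\pi)$ if $\Theta=\mathbb{Z}$ and over $\mathbb{R}$ if $\Theta=\mathbb{R}$.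
   Context: A centered complex-valued process $(B(t))_{t\in\Theta}$ is wide sense stationary if $\mathbb{E}B(t)=0$, $\mathbb{E}|B(t)|^2<\infty$ and $\mathbb{E}B(t+s)\overline{B(s)}=:K(t)$ does not depend on $s$. Its spectral measure is the finite measure $\mu$ on $[-\pi,\pi)$ (if $\Theta=\mathbb{Z}$) or on $\mathbb{R}$ (if $\Theta=\mathbb{R}$) with $K(t)=\int e^{itu}\mu(du)$. The process has the spectral representation $B(t)=\int e^{itu}\,\mathcal{W}(du)$, where $\mathcal{W}$ is an orthogonal random measure with $\mathbb{E}|\mathcal{W}(A)|^2=\mu(A)$. $H$ denotes the closed linear span of $\{B(t):t\in\Theta\}$ in the Hilbert space of square integrable random variables, with scalar product $(\xi,\eta)=\mathbb{E}(\xi\overline{\eta})$. The stochastic integral $\phi\mapsto\int\phi\,d\mathcal{W}$ is a linear isometry of $L_2(\mu)$ onto $H$; for $\xi\in H$ write $\xi=\int\phi_\xi(u)\,\mathcal{W}(du)$ with $\phi_\xi\in L_2(\mu)$. The linear filter $L$ with frequency characteristic $\ell$ is the operator $L\xi=\int\ell(u)\phi_\xi(u)\,\mathcal{W}(du)$ with domain $\mathcal{D}(L)=\{\xi\in H:\int|\ell(u)\phi_\xi(u)|^2\mu(du)<\infty\}$. *)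

theory Defs
  imports "HOL-Probability.Probability"
begin

text \<open>
  The time set \<open>\<Theta>\<close> is a subset of the reals, either \<open>\<int>\<close> or \<open>UNIV\<close>. Square integrable random
  variables are represented by functions rather than by classes modulo almost sure equality;
  accordingly the stochastic integral is determined only up to almost sure equality.
\<close>

definition freq_domain :: "real set \<Rightarrow> real set" where
  "freq_domain \<Theta> = (if \<Theta> = \<int> then {-pi..<pi} else UNIV)"

definition square_integrable :: "'a measure \<Rightarrow> ('a \<Rightarrow> complex) set" where
  "square_integrable M = {f \<in> borel_measurable M. integrable M (\<lambda>x. (cmod (f x))\<^sup>2)}"

definition wide_sense_stationary ::
    "'a measure \<Rightarrow> real set \<Rightarrow> (real \<Rightarrow> 'a \<Rightarrow> complex) \<Rightarrow> bool" where
  "wide_sense_stationary M \<Theta> B \<longleftrightarrow>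
     (\<forall>t\<in>\<Theta>. B t \<in> square_integrable M \<and> (\<integral>x. B t x \<partial>M) = 0) \<and>
     (\<forall>t\<in>\<Theta>. \<forall>s\<in>\<Theta>. \<forall>s'\<in>\<Theta>.
        (\<integral>x. B (t + s) x * cnj (B s x) \<partial>M) = (\<integral>x. B (t + s') x * cnj (B s' x) \<partial>M))"

definition covariance :: "'a measure \<Rightarrow> (real \<Rightarrow> 'a \<Rightarrow> complex) \<Rightarrow> real \<Rightarrow> complex" where
  "covariance M B t = (\<integral>x. B t x * cnj (B 0 x) \<partial>M)"

definition mean_square_continuous :: "'a measure \<Rightarrow> (real \<Rightarrow> 'a \<Rightarrow> complex) \<Rightarrow> bool" where
  "mean_square_continuous M B \<longleftrightarrow>
     (\<forall>s. ((\<lambda>t. \<integral>x. (cmod (B t x - B s x))\<^sup>2 \<partial>M) \<longlongrightarrow> 0) (at s))"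

definition spectral_measure ::
    "'a measure \<Rightarrow> real set \<Rightarrow> (real \<Rightarrow> 'a \<Rightarrow> complex) \<Rightarrow> real measure \<Rightarrow> bool" where
  "spectral_measure M \<Theta> B \<mu> \<longleftrightarrow>
     finite_measure \<mu> \<and> sets \<mu> = sets (restrict_space borel (freq_domain \<Theta>)) \<and>
     (\<forall>t\<in>\<Theta>. covariance M B t = (\<integral>u. iexp (t * u) \<partial>\<mu>))"

text \<open>
  Countable additivity in mean square is not listed: it follows from finite additivity,
  orthogonality and the identity with \<open>\<mu>\<close>.
\<close>

definition orthogonal_random_measure ::
    "'a measure \<Rightarrow> real measure \<Rightarrow> (real set \<Rightarrow> 'a \<Rightarrow> complex) \<Rightarrow> bool" where
  "orthogonal_random_measure M \<mu> W \<longleftrightarrow>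
     (\<forall>A\<in>sets \<mu>. W A \<in> square_integrable M \<and> (\<integral>x. (cmod (W A x))\<^sup>2 \<partial>M) = measure \<mu> A) \<and>
     (\<forall>A\<in>sets \<mu>. \<forall>A'\<in>sets \<mu>. A \<inter> A' = {} \<longrightarrow>
        (AE x in M. W (A \<union> A') x = W A x + W A' x) \<and>
        (\<integral>x. W A x * cnj (W A' x) \<partial>M) = 0)"

definition simple_stoch_integral ::
    "real measure \<Rightarrow> (real set \<Rightarrow> 'a \<Rightarrow> complex) \<Rightarrow> (real \<Rightarrow> complex) \<Rightarrow> 'a \<Rightarrow> complex" where
  "simple_stoch_integral \<mu> W s x = (\<Sum>y\<in>s ` space \<mu>. y * W (s -` {y} \<inter> space \<mu>) x)"

definition has_stoch_integral ::
    "'a measure \<Rightarrow> real measure \<Rightarrow> (real set \<Rightarrow> 'a \<Rightarrow> complex) \<Rightarrow>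
       (real \<Rightarrow> complex) \<Rightarrow> ('a \<Rightarrow> complex) \<Rightarrow> bool" where
  "has_stoch_integral M \<mu> W \<phi> \<xi> \<longleftrightarrow>
     \<phi> \<in> square_integrable \<mu> \<and> \<xi> \<in> square_integrable M \<and>
     (\<exists>s :: nat \<Rightarrow> real \<Rightarrow> complex.
        (\<forall>n. simple_function \<mu> (s n)) \<and>
        (\<lambda>n. \<integral>u. (cmod (\<phi> u - s n u))\<^sup>2 \<partial>\<mu>) \<longlonglongrightarrow> 0 \<and>
        (\<lambda>n. \<integral>x. (cmod (\<xi> x - simple_stoch_integral \<mu> W (s n) x))\<^sup>2 \<partial>M) \<longlonglongrightarrow> 0)"

definition stoch_integral ::
    "'a measure \<Rightarrow> real measure \<Rightarrow> (real set \<Rightarrow> 'a \<Rightarrow> complex) \<Rightarrow>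
       (real \<Rightarrow> complex) \<Rightarrow> 'a \<Rightarrow> complex" where
  "stoch_integral M \<mu> W \<phi> = (SOME \<xi>. has_stoch_integral M \<mu> W \<phi> \<xi>)"

definition spectral_random_measure ::
    "'a measure \<Rightarrow> real set \<Rightarrow> (real \<Rightarrow> 'a \<Rightarrow> complex) \<Rightarrow> real measure \<Rightarrow>
       (real set \<Rightarrow> 'a \<Rightarrow> complex) \<Rightarrow> bool" where
  "spectral_random_measure M \<Theta> B \<mu> W \<longleftrightarrow>
     orthogonal_random_measure M \<mu> W \<and>
     (\<forall>t\<in>\<Theta>. has_stoch_integral M \<mu> W (\<lambda>u. iexp (t * u)) (B t))"

definition closed_span ::
    "'a measure \<Rightarrow> real set \<Rightarrow> (real \<Rightarrow> 'a \<Rightarrow> complex) \<Rightarrow> ('a \<Rightarrow> complex) set" where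
  "closed_span M \<Theta> B =
     {\<xi> \<in> square_integrable M. \<forall>\<epsilon>>0. \<exists>F c. finite F \<and> F \<subseteq> \<Theta> \<and>
        (\<integral>x. (cmod (\<xi> x - (\<Sum>t\<in>F. c t * B t x)))\<^sup>2 \<partial>M) < \<epsilon>}"

text \<open>
  The function \<open>\<phi>\<^sub>\<xi>\<close> with \<open>\<xi> = \<integral>\<phi>\<^sub>\<xi> dW\<close>, which is unique \<open>\<mu>\<close>-almost everywhere. The choices made by
  \<open>SOME\<close> here and in the stochastic integral do not affect the filter up to almost sure equality.
\<close>

definition spectral_rep ::
    "'a measure \<Rightarrow> real measure \<Rightarrow> (real set \<Rightarrow> 'a \<Rightarrow> complex) \<Rightarrow>
       ('a \<Rightarrow> complex) \<Rightarrow> real \<Rightarrow> complex" where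
  "spectral_rep M \<mu> W \<xi> = (SOME \<phi>. has_stoch_integral M \<mu> W \<phi> \<xi>)"

definition linear_filter ::
    "'a measure \<Rightarrow> real measure \<Rightarrow> (real set \<Rightarrow> 'a \<Rightarrow> complex) \<Rightarrow> (real \<Rightarrow> complex) \<Rightarrow>
       ('a \<Rightarrow> complex) \<Rightarrow> 'a \<Rightarrow> complex" where
  "linear_filter M \<mu> W ell \<xi> = stoch_integral M \<mu> W (\<lambda>u. ell u * spectral_rep M \<mu> W \<xi> u)"

definition filter_domain ::
    "'a measure \<Rightarrow> real set \<Rightarrow> (real \<Rightarrow> 'a \<Rightarrow> complex) \<Rightarrow> real measure \<Rightarrow>
       (real set \<Rightarrow> 'a \<Rightarrow> complex) \<Rightarrow> (real \<Rightarrow> complex) \<Rightarrow> ('a \<Rightarrow> complex) set" where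
  "filter_domain M \<Theta> B \<mu> W ell =
     {\<xi> \<in> closed_span M \<Theta> B. integrable \<mu> (\<lambda>u. (cmod (ell u * spectral_rep M \<mu> W \<xi> u))\<^sup>2)}"

end

theory Submission
  imports Defs "HOL-Complex_Analysis.Cauchy_Integral_Theorem"
begin

text \<open>
  The stochastic integral carries the minimization problem isometrically into \<open>L\<^sub>2(\<mu>)\<close>. If \<open>Y\<close> has the
  spectral representation \<open>\<phi>\<close>, then \<open>Y - B(0)\<close> has the representation \<open>\<phi> - 1\<close> and \<open>LY\<close> has the
  representation \<open>\<ell>\<phi>\<close>, so the objective is \<open>\<integral> \<bar>\<phi> - 1\<bar>\<^sup>2 + \<bar>\<ell>\<phi>\<bar>\<^sup>2 d\<mu>\<close>. Completing the square at each
  frequency (lemma \<open>power2_penalty_eq\<close>) turns the integrand into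
  \<open>(1 + \<bar>\<ell>\<bar>\<^sup>2) \<bar>\<phi> - 1 / (1 + \<bar>\<ell>\<bar>\<^sup>2)\<bar>\<^sup>2 + \<bar>\<ell>\<bar>\<^sup>2 / (1 + \<bar>\<ell>\<bar>\<^sup>2)\<close>. The first summand vanishes exactly for
  \<open>\<phi> = 1 / (1 + \<bar>\<ell>\<bar>\<^sup>2)\<close>, which gives the minimizer and its uniqueness, and the second one integrates to
  the minimum (lemma \<open>objective_eq\<close>).

  What has to be justified is the dictionary between \<open>H\<close> and \<open>L\<^sub>2(\<mu>)\<close>. The stochastic integral of a
  simple function is isometric because \<open>W\<close> has orthogonal values on disjoint sets, and it extends to
  all of \<open>L\<^sub>2(\<mu>)\<close> by completeness of the square integrable random variables
  (\<open>l2_complete\<close>, \<open>has_stoch_integral_exists\<close>). Every \<open>Y\<close> in \<open>H\<close> has a representation: it is a limit of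
  linear combinations of the \<open>B(t)\<close>, the matching combinations of the harmonics \<open>e\<^sup>i\<^sup>t\<^sup>u\<close> are then Cauchy
  in \<open>L\<^sub>2(\<mu>)\<close>, and their limit represents \<open>Y\<close> (\<open>closed_span_has_spectral_rep\<close>).

  Conversely, the candidate minimizer lies in \<open>H\<close> only because the harmonics span a dense subspace of
  \<open>L\<^sub>2(\<mu>)\<close>. On the unit circle, Stone and Weierstrass approximate a continuous function uniformly by
  polynomials in the real and imaginary parts, which are trigonometric polynomials; functions
  \<open>max 0 (1 - n dist(z, A))\<close> then reach indicators of closed sets, and a Dynkin argument reaches those of
  Borel sets. In discrete time the frequency interval is a bijective image of the circle. In
  continuous time the line is wrapped around circles of growing length, by \<open>u \<mapsto> e\<^sup>i\<^sup>u\<^sup>/\<^sup>n\<close>, and every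
  frequency is eventually recovered from its image (\<open>harmonics_dense\<close>).
\<close>

section \<open>The space of square integrable functions\<close>

definition l2norm :: "'a measure \<Rightarrow> ('a \<Rightarrow> complex) \<Rightarrow> real" where
  "l2norm M f = sqrt (\<integral>x. (cmod (f x))\<^sup>2 \<partial>M)"

lemma l2norm_nonneg [simp]: "0 \<le> l2norm M f"
  by (simp add: l2norm_def)

lemma l2norm_power2: "(l2norm M f)\<^sup>2 = (\<integral>x. (cmod (f x))\<^sup>2 \<partial>M)"
  by (simp add: l2norm_def)

lemma l2norm_cmult [simp]: "l2norm M (\<lambda>x. c * f x) = cmod c * l2norm M f"
  by (simp add: l2norm_def norm_mult power_mult_distrib real_sqrt_mult)

lemma l2norm_minus_commute: "l2norm M (\<lambda>x. f x - g x) = l2norm M (\<lambda>x. g x - f x)"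
  by (simp add: l2norm_def norm_minus_commute)

lemma l2norm_cong_AE:
  assumes "f \<in> borel_measurable M" "g \<in> borel_measurable M" "AE x in M. f x = g x"
  shows "l2norm M f = l2norm M g"
proof -
  note [measurable] = assms(1,2)
  show ?thesis
    unfolding l2norm_def using assms(3)
    by (intro arg_cong[where f = sqrt] integral_cong_AE) auto
qed

lemma square_integrable_measurable: "f \<in> square_integrable M \<Longrightarrow> f \<in> borel_measurable M"
  by (simp add: square_integrable_def)

lemma square_integrable_cmult:
  "f \<in> square_integrable M \<Longrightarrow> (\<lambda>x. c * f x) \<in> square_integrable M"
  by (auto simp: square_integrable_def norm_mult power_mult_distrib)

lemma norm_add_power2_le: "(norm (a + b))\<^sup>2 \<le> 2 * (norm a)\<^sup>2 + 2 * (norm b)\<^sup>2"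
proof -
  have "(norm (a + b))\<^sup>2 \<le> (norm a + norm b)\<^sup>2"
    by (intro power_mono norm_triangle_ineq) auto
  also have "\<dots> \<le> 2 * (norm a)\<^sup>2 + 2 * (norm b)\<^sup>2"
    using zero_le_power2[of "norm a - norm b"] by (simp add: power2_sum power2_diff)
  finally show ?thesis .
qed

lemma square_integrable_add:
  assumes "f \<in> square_integrable M" "g \<in> square_integrable M"
  shows "(\<lambda>x. f x + g x) \<in> square_integrable M"
proof -
  have [measurable]: "f \<in> borel_measurable M" "g \<in> borel_measurable M"
    using assms by (simp_all add: square_integrable_def)
  have "integrable M (\<lambda>x. (cmod (f x + g x))\<^sup>2)"
    by (rule Bochner_Integration.integrable_bound[where f = "\<lambda>x. 2 * (cmod (f x))\<^sup>2 + 2 * (cmod (g x))\<^sup>2"])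
       (use assms in \<open>auto simp: square_integrable_def norm_add_power2_le\<close>)
  then show ?thesis
    by (simp add: square_integrable_def)
qed

lemma square_integrable_lincomb:
  assumes "f \<in> square_integrable M" "g \<in> square_integrable M"
  shows "(\<lambda>x. a * f x + b * g x) \<in> square_integrable M"
  by (intro square_integrable_add square_integrable_cmult assms)

lemma square_integrable_diff:
  assumes "f \<in> square_integrable M" "g \<in> square_integrable M"
  shows "(\<lambda>x. f x - g x) \<in> square_integrable M"
  using square_integrable_lincomb[OF assms, of 1 "-1"] by simp

lemma square_integrable_zero: "(\<lambda>x. 0) \<in> square_integrable M"
  by (simp add: square_integrable_def)

lemma square_integrable_sum:
  assumes "\<And>i. i \<in> I \<Longrightarrow> f i \<in> square_integrable M"
  shows "(\<lambda>x. \<Sum>i\<in>I. f i x) \<in> square_integrable M"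
  using assms
  by (induction I rule: infinite_finite_induct)
     (auto intro: square_integrable_add square_integrable_zero)

lemma square_integrable_bounded:
  assumes "finite_measure M" "f \<in> borel_measurable M" "\<And>x. x \<in> space M \<Longrightarrow> cmod (f x) \<le> K"
  shows "f \<in> square_integrable M"
proof -
  interpret finite_measure M by fact
  note [measurable] = assms(2)
  have "integrable M (\<lambda>x. (cmod (f x))\<^sup>2)"
    by (rule integrable_const_bound[where B = "K\<^sup>2"]) (auto intro!: AE_I2 power_mono assms(3))
  then show ?thesis
    by (simp add: square_integrable_def)
qed

lemma l2norm_mono:
  assumes "f \<in> borel_measurable M" "g \<in> square_integrable M"
    and "\<And>x. x \<in> space M \<Longrightarrow> cmod (f x) \<le> cmod (g x)"
  shows "l2norm M f \<le> l2norm M g"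
  unfolding l2norm_def
proof (intro real_sqrt_le_mono integral_mono_AE')
  show "integrable M (\<lambda>x. (cmod (g x))\<^sup>2)"
    using assms(2) by (simp add: square_integrable_def)
qed (auto intro!: AE_I2 power_mono assms)

text \<open>
  Minkowski's inequality without Hoelder's: the pointwise bound
  \<open>\<bar>x + y\<bar>\<^sup>2 \<le> (p + q) (\<bar>x\<bar>\<^sup>2 / p + \<bar>y\<bar>\<^sup>2 / q)\<close> integrates to at most \<open>(p + q)\<^sup>2\<close> as soon as \<open>p\<close> and \<open>q\<close> dominate
  the two norms. The slack \<open>e / 2\<close> in \<open>p\<close> and \<open>q\<close> keeps them positive when a norm is zero.
\<close>
lemma l2norm_triangle:
  assumes f: "f \<in> square_integrable M" and g: "g \<in> square_integrable M"
  shows "l2norm M (\<lambda>x. f x + g x) \<le> l2norm M f + l2norm M g"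
proof (rule field_le_epsilon)
  fix e :: real assume "e > 0"
  define p q where "p = l2norm M f + e / 2" and "q = l2norm M g + e / 2"
  have pq: "p > 0" "q > 0"
    using \<open>e > 0\<close> by (auto simp: p_def q_def intro!: add_nonneg_pos)
  have i: "integrable M (\<lambda>x. (cmod (f x))\<^sup>2)" "integrable M (\<lambda>x. (cmod (g x))\<^sup>2)"
    using f g by (simp_all add: square_integrable_def)
  have pt: "(cmod (f x + g x))\<^sup>2 \<le> (p + q) * ((cmod (f x))\<^sup>2 / p + (cmod (g x))\<^sup>2 / q)" for x
  proof -
    have "(cmod (f x + g x))\<^sup>2 \<le> (cmod (f x) + cmod (g x))\<^sup>2"
      by (intro power_mono norm_triangle_ineq) auto
    also have "\<dots> \<le> (p + q) * ((cmod (f x))\<^sup>2 / p + (cmod (g x))\<^sup>2 / q)"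
    proof -
      have "(p + q) * ((cmod (f x))\<^sup>2 / p + (cmod (g x))\<^sup>2 / q) - (cmod (f x) + cmod (g x))\<^sup>2
              = (q * cmod (f x) - p * cmod (g x))\<^sup>2 / (p * q)"
        using pq by (simp add: field_simps power2_eq_square)
      moreover have "\<dots> \<ge> 0"
        using pq by simp
      ultimately show ?thesis by linarith
    qed
    finally show ?thesis .
  qed
  have "(l2norm M (\<lambda>x. f x + g x))\<^sup>2
          \<le> (\<integral>x. (p + q) * ((cmod (f x))\<^sup>2 / p + (cmod (g x))\<^sup>2 / q) \<partial>M)"
    unfolding l2norm_power2
    by (rule integral_mono_AE') (use i pt pq in auto)
  also have "\<dots> = (p + q) * ((l2norm M f)\<^sup>2 / p + (l2norm M g)\<^sup>2 / q)"
    using i by (simp add: l2norm_power2)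
  also have "\<dots> \<le> (p + q) * (p\<^sup>2 / p + q\<^sup>2 / q)"
    using pq \<open>e > 0\<close>
    by (intro mult_left_mono add_mono divide_right_mono power_mono) (auto simp: p_def q_def)
  also have "\<dots> = (p + q)\<^sup>2"
    using pq by (simp add: power2_eq_square)
  finally have "l2norm M (\<lambda>x. f x + g x) \<le> p + q"
    by (rule power2_le_imp_le) (use pq in auto)
  then show "l2norm M (\<lambda>x. f x + g x) \<le> l2norm M f + l2norm M g + e"
    by (simp add: p_def q_def)
qed

lemma l2norm_diff_triangle:
  assumes "f \<in> square_integrable M" "g \<in> square_integrable M" "h \<in> square_integrable M"
  shows "l2norm M (\<lambda>x. f x - h x) \<le> l2norm M (\<lambda>x. f x - g x) + l2norm M (\<lambda>x. g x - h x)"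
  using l2norm_triangle[OF square_integrable_diff[OF assms(1,2)] square_integrable_diff[OF assms(2,3)]]
  by simp

lemma l2norm_reverse_triangle:
  assumes "f \<in> square_integrable M" "g \<in> square_integrable M"
  shows "\<bar>l2norm M f - l2norm M g\<bar> \<le> l2norm M (\<lambda>x. f x - g x)"
  using l2norm_diff_triangle[OF assms square_integrable_zero]
    l2norm_diff_triangle[OF assms(2,1) square_integrable_zero] l2norm_minus_commute[of M f g]
  by simp

lemma lincomb_tolerance:
  fixes a b e :: real
  assumes "0 \<le> a" "0 \<le> b" "0 < e"
  obtains d where "0 < d" "\<And>p q. p < d \<Longrightarrow> q < d \<Longrightarrow> a * p + b * q < e"
proof -
  \<comment> \<open>The denominator is positive even if both coefficients vanish.\<close>
  define d where "d = e / (a + b + 1)"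
  have pos: "a + b + 1 > 0"
    using assms by linarith
  then have "d > 0"
    using assms by (simp add: d_def)
  moreover have "a * p + b * q < e" if "p < d" "q < d" for p q
  proof -
    have "a * p + b * q \<le> a * d + b * d"
      using that assms by (intro add_mono mult_left_mono) auto
    also have "\<dots> < (a + b + 1) * d"
      using \<open>d > 0\<close> by (simp add: algebra_simps)
    also have "\<dots> = e"
      using pos by (simp add: d_def)
    finally show ?thesis .
  qed
  ultimately show thesis
    by (rule that)
qed

lemma l2norm_lincomb_diff:
  assumes "f \<in> square_integrable M" "g \<in> square_integrable M"
    "f' \<in> square_integrable M" "g' \<in> square_integrable M"
  shows "l2norm M (\<lambda>x. (a * f x + b * g x) - (a * f' x + b * g' x))
           \<le> cmod a * l2norm M (\<lambda>x. f x - f' x) + cmod b * l2norm M (\<lambda>x. g x - g' x)"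
proof -
  have "l2norm M (\<lambda>x. a * (f x - f' x) + b * (g x - g' x))
          \<le> cmod a * l2norm M (\<lambda>x. f x - f' x) + cmod b * l2norm M (\<lambda>x. g x - g' x)"
    using l2norm_triangle[of "\<lambda>x. a * (f x - f' x)" M "\<lambda>x. b * (g x - g' x)"] assms
    by (simp add: square_integrable_diff square_integrable_cmult)
  then show ?thesis
    by (simp add: algebra_simps)
qed

lemma l2norm_eq_0_iff:
  assumes "f \<in> square_integrable M"
  shows "l2norm M f = 0 \<longleftrightarrow> (AE x in M. f x = 0)"
  using assms unfolding l2norm_def
  by (simp add: square_integrable_def integral_nonneg_eq_0_iff_AE)

lemma l2norm_dominated_convergence:
  assumes s: "\<And>n. s n \<in> borel_measurable M" and f: "f \<in> borel_measurable M"
    and g: "g \<in> square_integrable M"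
    and lim: "\<And>x. x \<in> space M \<Longrightarrow> (\<lambda>n. s n x) \<longlonglongrightarrow> f x"
    and dom: "\<And>n x. x \<in> space M \<Longrightarrow> cmod (f x - s n x) \<le> cmod (g x)"
  shows "(\<lambda>n. l2norm M (\<lambda>x. f x - s n x)) \<longlonglongrightarrow> 0"
proof -
  note [measurable] = s f
  have "(\<lambda>n. \<integral>x. (cmod (f x - s n x))\<^sup>2 \<partial>M) \<longlonglongrightarrow> (\<integral>x. 0 \<partial>M)"
  proof (rule integral_dominated_convergence)
    show "integrable M (\<lambda>x. (cmod (g x))\<^sup>2)"
      using g by (simp add: square_integrable_def)
    show "AE x in M. (\<lambda>n. (cmod (f x - s n x))\<^sup>2) \<longlonglongrightarrow> 0"
    proof (rule AE_I2)
      fix x assume "x \<in> space M"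
      then have "(\<lambda>n. (cmod (f x - s n x))\<^sup>2) \<longlonglongrightarrow> (cmod (f x - f x))\<^sup>2"
        by (intro tendsto_intros lim)
      then show "(\<lambda>n. (cmod (f x - s n x))\<^sup>2) \<longlonglongrightarrow> 0" by simp
    qed
  qed (auto intro!: AE_I2 power_mono dom)
  from tendsto_real_sqrt[OF this] show ?thesis
    by (simp add: l2norm_def)
qed

text \<open>
  Square integrability implies integrability on a finite measure space because
  \<open>\<bar>f\<bar> \<le> \<bar>f\<bar>\<^sup>2 / t + t\<close>. The free weight \<open>t\<close> lets a geometric sequence of \<open>L\<^sub>2\<close> norms give a geometric
  sequence of \<open>L\<^sub>1\<close> norms.
\<close>
lemma integral_norm_le_l2norm:
  assumes "finite_measure M" "f \<in> square_integrable M" "t > 0"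
  shows "integrable M (\<lambda>x. cmod (f x))"
    and "(\<integral>x. cmod (f x) \<partial>M) \<le> (l2norm M f)\<^sup>2 / t + t * measure M (space M)"
proof -
  interpret finite_measure M by fact
  have [measurable]: "f \<in> borel_measurable M" and i: "integrable M (\<lambda>x. (cmod (f x))\<^sup>2)"
    using assms(2) by (simp_all add: square_integrable_def)
  have le: "cmod (f x) \<le> (cmod (f x))\<^sup>2 / t + t" for x
  proof (cases "cmod (f x) \<le> t")
    case False
    then have "cmod (f x) * t \<le> (cmod (f x))\<^sup>2"
      by (simp add: power2_eq_square mult_left_mono)
    then show ?thesis
      using \<open>t > 0\<close> by (simp add: field_simps) (smt (verit) zero_less_power2 mult_pos_pos)
  qed (use \<open>t > 0\<close> in \<open>simp add: add_increasing\<close>)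
  have i': "integrable M (\<lambda>x. (cmod (f x))\<^sup>2 / t + t)"
    using i by simp
  show "integrable M (\<lambda>x. cmod (f x))"
    by (rule Bochner_Integration.integrable_bound[OF i']) (auto intro!: AE_I2 order_trans[OF le])
  then have "(\<integral>x. cmod (f x) \<partial>M) \<le> (\<integral>x. (cmod (f x))\<^sup>2 / t + t \<partial>M)"
    using i' le by (intro integral_mono) auto
  also have "\<dots> = (l2norm M f)\<^sup>2 / t + t * measure M (space M)"
    using i by (simp add: l2norm_power2)
  finally show "(\<integral>x. cmod (f x) \<partial>M) \<le> (l2norm M f)\<^sup>2 / t + t * measure M (space M)" .
qed

text \<open>
  Balls of \<open>L\<^sub>2\<close> are closed under almost everywhere convergence, by Fatou's lemma.
\<close>
lemma l2norm_le_Fatou: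
  assumes s: "\<And>n. s n \<in> square_integrable M" and f: "f \<in> borel_measurable M"
    and lim: "AE x in M. (\<lambda>n. s n x) \<longlonglongrightarrow> f x"
    and bound: "eventually (\<lambda>n. l2norm M (s n) \<le> e) sequentially"
  shows "f \<in> square_integrable M" "l2norm M f \<le> e"
proof -
  have [measurable]: "\<And>n. s n \<in> borel_measurable M"
    and i: "\<And>n. integrable M (\<lambda>x. (cmod (s n x))\<^sup>2)"
    using s by (simp_all add: square_integrable_def)
  note [measurable] = f
  from eventually_happens[OF bound] have "e \<ge> 0"
    by (auto intro: order_trans[OF l2norm_nonneg])
  have "(\<integral>\<^sup>+x. ennreal ((cmod (f x))\<^sup>2) \<partial>M)
          = (\<integral>\<^sup>+x. liminf (\<lambda>n. ennreal ((cmod (s n x))\<^sup>2)) \<partial>M)"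
  proof (rule nn_integral_cong_AE, use lim in eventually_elim)
    fix x assume "(\<lambda>n. s n x) \<longlonglongrightarrow> f x"
    then have "(\<lambda>n. ennreal ((cmod (s n x))\<^sup>2)) \<longlonglongrightarrow> ennreal ((cmod (f x))\<^sup>2)"
      by (intro tendsto_ennrealI tendsto_intros)
    then show "ennreal ((cmod (f x))\<^sup>2) = liminf (\<lambda>n. ennreal ((cmod (s n x))\<^sup>2))"
      by (intro lim_imp_Liminf[symmetric]) simp_all
  qed
  also have "\<dots> \<le> liminf (\<lambda>n. \<integral>\<^sup>+x. ennreal ((cmod (s n x))\<^sup>2) \<partial>M)"
    by (rule nn_integral_liminf) auto
  also have "\<dots> = liminf (\<lambda>n. ennreal ((l2norm M (s n))\<^sup>2))"
    using i by (simp add: nn_integral_eq_integral l2norm_power2)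
  also have "\<dots> \<le> liminf (\<lambda>n::nat. ennreal (e\<^sup>2))"
    by (intro Liminf_mono eventually_mono[OF bound] ennreal_leI power_mono) auto
  also have "\<dots> = ennreal (e\<^sup>2)"
    by (simp add: Liminf_const)
  finally have le: "(\<integral>\<^sup>+x. ennreal ((cmod (f x))\<^sup>2) \<partial>M) \<le> ennreal (e\<^sup>2)" .
  then have int: "integrable M (\<lambda>x. (cmod (f x))\<^sup>2)"
    by (intro integrableI_nonneg) (auto intro: le_less_trans)
  then show "f \<in> square_integrable M"
    using f by (simp add: square_integrable_def)
  have "(l2norm M f)\<^sup>2 \<le> e\<^sup>2"
    using le int by (simp add: nn_integral_eq_integral l2norm_power2)
  then show "l2norm M f \<le> e"
    using \<open>e \<ge> 0\<close> power2_le_imp_le by blast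
qed

text \<open>
  The increments have summable \<open>L\<^sub>1\<close> norms, so their pointwise sum is finite almost everywhere and the
  telescoping series converges absolutely there.
\<close>
lemma AE_convergent_of_fast_Cauchy:
  assumes M: "finite_measure M" and g: "\<And>k. g k \<in> square_integrable M"
    and fast: "\<And>k. l2norm M (\<lambda>x. g (Suc k) x - g k x) \<le> (1 / 2) ^ k"
  shows "AE x in M. convergent (\<lambda>k. g k x)"
proof -
  define d where "d k = (\<lambda>x. g (Suc k) x - g k x)" for k
  have d: "d k \<in> square_integrable M" for k
    unfolding d_def by (intro square_integrable_diff g)
  have [measurable]: "d k \<in> borel_measurable M" for k
    using d by (simp add: square_integrable_def)
  define C where "C = 1 + measure M (space M)"
  have "C \<ge> 0" by (simp add: C_def)
  have le: "(\<integral>\<^sup>+x. ennreal (cmod (d k x)) \<partial>M) \<le> ennreal ((1 / 2) ^ k * C)" for k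
  proof -
    have p: "(1 / 2 :: real) ^ k > 0" by simp
    have "(\<integral>x. cmod (d k x) \<partial>M) \<le> (l2norm M (d k))\<^sup>2 / (1 / 2) ^ k + (1 / 2) ^ k * measure M (space M)"
      by (rule integral_norm_le_l2norm(2)[OF M d p])
    also have "\<dots> \<le> ((1 / 2) ^ k)\<^sup>2 / (1 / 2) ^ k + (1 / 2) ^ k * measure M (space M)"
      using fast[of k] by (intro add_right_mono divide_right_mono power_mono) (auto simp: d_def)
    also have "\<dots> = (1 / 2) ^ k * C"
      by (simp add: C_def power2_eq_square distrib_left)
    finally show ?thesis
      using integral_norm_le_l2norm(1)[OF M d p]
      by (simp add: nn_integral_eq_integral ennreal_leI)
  qed
  have sm: "summable (\<lambda>k. (1 / 2 :: real) ^ k * C)"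
    by (intro summable_mult2 summable_geometric) simp
  have "(\<integral>\<^sup>+x. (\<Sum>k. ennreal (cmod (d k x))) \<partial>M) = (\<Sum>k. \<integral>\<^sup>+x. ennreal (cmod (d k x)) \<partial>M)"
    by (rule nn_integral_suminf) auto
  also have "\<dots> \<le> (\<Sum>k. ennreal ((1 / 2) ^ k * C))"
    by (intro suminf_le le) auto
  also have "\<dots> = ennreal (\<Sum>k. (1 / 2) ^ k * C)"
    using sm \<open>C \<ge> 0\<close> by (intro suminf_ennreal2) auto
  finally have "(\<integral>\<^sup>+x. (\<Sum>k. ennreal (cmod (d k x))) \<partial>M) \<noteq> \<infinity>"
    by (auto simp: top_unique)
  then have "AE x in M. (\<Sum>k. ennreal (cmod (d k x))) \<noteq> \<infinity>"
    by (intro nn_integral_PInf_AE) auto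
  then show ?thesis
  proof eventually_elim
    fix x assume "(\<Sum>k. ennreal (cmod (d k x))) \<noteq> \<infinity>"
    then have "summable (\<lambda>k. cmod (d k x))"
      by (intro summable_suminf_not_top) auto
    then have "summable (\<lambda>k. d k x)"
      by (rule summable_norm_cancel)
    then have "convergent (\<lambda>n. \<Sum>k<n. d k x)"
      by (simp add: summable_iff_convergent)
    then have "convergent (\<lambda>n. g n x - g 0 x)"
      using sum_lessThan_telescope[of "\<lambda>k. g k x"] by (simp add: d_def)
    from convergent_add[OF this convergent_const[of "g 0 x"]]
    show "convergent (\<lambda>k. g k x)" by simp
  qed
qed

text \<open>
  The Riesz-Fischer theorem: a subsequence with geometrically small increments converges almost
  everywhere, and Fatou's lemma transfers the Cauchy estimate to its limit.
\<close>
lemma l2_complete: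
  assumes M: "finite_measure M" and f: "\<And>n. f n \<in> square_integrable M"
    and Cauchy: "\<And>e. e > 0 \<Longrightarrow> \<exists>N. \<forall>m\<ge>N. \<forall>n\<ge>N. l2norm M (\<lambda>x. f m x - f n x) < e"
  obtains h where "h \<in> square_integrable M" "(\<lambda>n. l2norm M (\<lambda>x. h x - f n x)) \<longlonglongrightarrow> 0"
proof -
  have "\<exists>N. \<forall>k. \<forall>m\<ge>N k. \<forall>n\<ge>N k. l2norm M (\<lambda>x. f m x - f n x) < (1 / 2) ^ k"
    by (rule choice) (use Cauchy in auto)
  then obtain N where N: "\<And>k m n. m \<ge> N k \<Longrightarrow> n \<ge> N k \<Longrightarrow> l2norm M (\<lambda>x. f m x - f n x) < (1 / 2) ^ k"
    by blast
  \<comment> \<open>A monotone choice of indices that lie beyond each threshold \<open>N k\<close> and tend to infinity.\<close>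
  define r where "r k = k + (\<Sum>j\<le>k. N j)" for k
  have r: "r k \<ge> N k" "r k \<le> r (Suc k)" "r k \<ge> k" for k
    using member_le_sum[of k "{..k}" N] by (auto simp: r_def)
  have conv: "AE x in M. convergent (\<lambda>k. f (r k) x)"
  proof (rule AE_convergent_of_fast_Cauchy[OF M f])
    show "l2norm M (\<lambda>x. f (r (Suc k)) x - f (r k) x) \<le> (1 / 2) ^ k" for k
      using N[of k "r (Suc k)" "r k"] r(1)[of k] r(2)[of k] by auto
  qed
  have [measurable]: "f n \<in> borel_measurable M" for n
    using f by (simp add: square_integrable_def)
  define h where "h x = lim (\<lambda>k. f (r k) x)" for x
  have [measurable]: "h \<in> borel_measurable M"
    unfolding h_def by measurable
  have close: "(\<lambda>x. h x - f n x) \<in> square_integrable M \<and> l2norm M (\<lambda>x. h x - f n x) \<le> e"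
    if n: "\<forall>m\<ge>K. \<forall>n\<ge>K. l2norm M (\<lambda>x. f m x - f n x) < e" "n \<ge> K" for n K e
  proof -
    have "AE x in M. (\<lambda>k. f (r k) x - f n x) \<longlonglongrightarrow> h x - f n x"
      using conv by eventually_elim (auto simp: h_def convergent_LIMSEQ_iff intro!: tendsto_intros)
    moreover have "eventually (\<lambda>k. l2norm M (\<lambda>x. f (r k) x - f n x) \<le> e) sequentially"
      using eventually_ge_at_top[of K]
    proof eventually_elim
      fix k assume "K \<le> k"
      with r(3)[of k] have "r k \<ge> K" by simp
      with n show "l2norm M (\<lambda>x. f (r k) x - f n x) \<le> e" by (simp add: less_imp_le)
    qed
    moreover have "(\<lambda>x. f (r k) x - f n x) \<in> square_integrable M" for k
      by (intro square_integrable_diff f)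
    ultimately show ?thesis
      using l2norm_le_Fatou[of "\<lambda>k x. f (r k) x - f n x" M "\<lambda>x. h x - f n x" e] by simp
  qed
  obtain K where "\<forall>m\<ge>K. \<forall>n\<ge>K. l2norm M (\<lambda>x. f m x - f n x) < 1"
    using Cauchy[of 1] by auto
  with close[of K 1 K] have "(\<lambda>x. h x - f K x) \<in> square_integrable M" by simp
  from square_integrable_add[OF this f[of K]] have h: "h \<in> square_integrable M" by simp
  have "(\<lambda>n. l2norm M (\<lambda>x. h x - f n x)) \<longlonglongrightarrow> 0"
  proof (rule LIMSEQ_I)
    fix e :: real assume "e > 0"
    then obtain K where "\<forall>m\<ge>K. \<forall>n\<ge>K. l2norm M (\<lambda>x. f m x - f n x) < e / 2"
      using Cauchy[of "e / 2"] by auto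
    with close[of K "e / 2"] \<open>e > 0\<close>
    show "\<exists>K. \<forall>n\<ge>K. norm (l2norm M (\<lambda>x. h x - f n x) - 0) < e"
      by (intro exI[of _ K]) fastforce
  qed
  with h that show thesis by blast
qed

lemma l2_Cauchy_of_convergent:
  assumes f: "f \<in> square_integrable N" and s: "\<And>n. s n \<in> square_integrable N"
    and lim: "(\<lambda>n. l2norm N (\<lambda>x. f x - s n x)) \<longlonglongrightarrow> 0" and "e > 0"
  shows "\<exists>K. \<forall>m\<ge>K. \<forall>n\<ge>K. l2norm N (\<lambda>x. s m x - s n x) < e"
proof -
  from order_tendstoD(2)[OF lim, of "e / 2"] \<open>e > 0\<close>
  obtain K where K: "\<And>n. n \<ge> K \<Longrightarrow> l2norm N (\<lambda>x. f x - s n x) < e / 2"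
    by (auto simp: eventually_sequentially)
  have "l2norm N (\<lambda>x. s m x - s n x) < e" if "m \<ge> K" "n \<ge> K" for m n
    using l2norm_diff_triangle[OF s[of m] f s[of n]] K[OF that(1)] K[OF that(2)]
      l2norm_minus_commute[of N f "s m"] by linarith
  then show ?thesis by blast
qed

lemma square_integrable_simple_approx:
  assumes f: "f \<in> square_integrable M"
  obtains s where "\<And>n. simple_function M (s n)" "(\<lambda>n. l2norm M (\<lambda>x. f x - s n x)) \<longlonglongrightarrow> 0"
proof -
  have f_meas: "f \<in> borel_measurable M"
    using f by (rule square_integrable_measurable)
  from borel_measurable_implies_sequence_metric[OF this, of 0]
  obtain s where s: "\<And>i. simple_function M (s i)"
    and lim: "\<And>x. x \<in> space M \<Longrightarrow> (\<lambda>i. s i x) \<longlonglongrightarrow> f x"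
    and dom: "\<And>i x. x \<in> space M \<Longrightarrow> cmod (s i x) \<le> 2 * cmod (f x)"
    by (simp add: dist_norm) metis
  have "(\<lambda>n. l2norm M (\<lambda>x. f x - s n x)) \<longlonglongrightarrow> 0"
  proof (rule l2norm_dominated_convergence[OF _ f_meas square_integrable_cmult[OF f, of 3]])
    show "s n \<in> borel_measurable M" for n
      by (rule borel_measurable_simple_function[OF s])
    show "cmod (f x - s n x) \<le> cmod (3 * f x)" if "x \<in> space M" for n x
      using norm_triangle_ineq4[of "f x" "s n x"] dom[OF that, of n] by (simp add: norm_mult)
  qed (rule lim)
  with s that show thesis by blast
qed

lemma integrable_mult_cnj:
  assumes "f \<in> square_integrable M" "g \<in> square_integrable M"
  shows "integrable M (\<lambda>x. f x * cnj (g x))"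
proof (rule Bochner_Integration.integrable_bound)
  have [measurable]: "f \<in> borel_measurable M" "g \<in> borel_measurable M"
    using assms by (simp_all add: square_integrable_def)
  have [measurable]: "cnj \<in> borel_measurable borel"
    by (intro borel_measurable_continuous_onI continuous_intros)
  show "(\<lambda>x. f x * cnj (g x)) \<in> borel_measurable M"
    by measurable
  show "integrable M (\<lambda>x. (cmod (f x))\<^sup>2 + (cmod (g x))\<^sup>2)"
    using assms by (simp add: square_integrable_def)
  show "AE x in M. norm (f x * cnj (g x)) \<le> norm ((cmod (f x))\<^sup>2 + (cmod (g x))\<^sup>2)"
  proof (rule AE_I2)
    fix x
    have "2 * (cmod (f x) * cmod (g x)) \<le> (cmod (f x))\<^sup>2 + (cmod (g x))\<^sup>2"
      using sum_squares_bound[of "cmod (f x)" "cmod (g x)"] by simp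
    moreover have "0 \<le> cmod (f x) * cmod (g x)" by simp
    ultimately have "cmod (f x) * cmod (g x) \<le> (cmod (f x))\<^sup>2 + (cmod (g x))\<^sup>2" by linarith
    then show "norm (f x * cnj (g x)) \<le> norm ((cmod (f x))\<^sup>2 + (cmod (g x))\<^sup>2)"
      by (simp add: norm_mult)
  qed
qed

lemma l2norm_add_orthogonal:
  assumes f: "f \<in> square_integrable M" and g: "g \<in> square_integrable M"
    and orth: "(\<integral>x. f x * cnj (g x) \<partial>M) = 0"
  shows "(l2norm M (\<lambda>x. f x + g x))\<^sup>2 = (l2norm M f)\<^sup>2 + (l2norm M g)\<^sup>2"
proof -
  have i: "integrable M (\<lambda>x. f x * cnj (g x))"
    by (rule integrable_mult_cnj[OF f g])
  have "(\<integral>x. Re (f x * cnj (g x)) \<partial>M) = 0"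
    using i orth by (simp only: integral_Re) simp
  moreover have "integrable M (\<lambda>x. Re (f x * cnj (g x)))"
    by (rule integrable_Re[OF i])
  moreover have "(cmod (f x + g x))\<^sup>2 = (cmod (f x))\<^sup>2 + (cmod (g x))\<^sup>2 + 2 * Re (f x * cnj (g x))" for x
    by (simp add: cmod_power2 power2_sum)
  ultimately show ?thesis
    using f g by (simp add: l2norm_power2 square_integrable_def del: times_complex.sel complex_cnj)
qed

text \<open>
  Pythagoras, which is what makes the integral of a simple function isometric.
\<close>
lemma l2norm_sum_orthogonal:
  assumes "finite I" and "\<And>i. i \<in> I \<Longrightarrow> f i \<in> square_integrable M"
    and "\<And>i j. i \<in> I \<Longrightarrow> j \<in> I \<Longrightarrow> i \<noteq> j \<Longrightarrow> (\<integral>x. f i x * cnj (f j x) \<partial>M) = 0"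
  shows "(l2norm M (\<lambda>x. \<Sum>i\<in>I. f i x))\<^sup>2 = (\<Sum>i\<in>I. (l2norm M (f i))\<^sup>2)"
  using assms
proof (induction I)
  case empty
  then show ?case by (simp add: l2norm_def)
next
  case (insert i I)
  have "(\<integral>x. f i x * cnj (\<Sum>j\<in>I. f j x) \<partial>M) = (\<Sum>j\<in>I. \<integral>x. f i x * cnj (f j x) \<partial>M)"
    using insert.prems by (simp add: sum_distrib_left integrable_mult_cnj)
  also have "\<dots> = 0"
    using insert by (intro sum.neutral) (metis insertCI)
  finally have "(l2norm M (\<lambda>x. f i x + (\<Sum>j\<in>I. f j x)))\<^sup>2
                  = (l2norm M (f i))\<^sup>2 + (l2norm M (\<lambda>x. \<Sum>j\<in>I. f j x))\<^sup>2"
    using insert.prems by (intro l2norm_add_orthogonal square_integrable_sum) auto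
  then show ?case
    using insert by simp
qed

section \<open>The stochastic integral\<close>

locale orthogonal_measure =
  fixes M :: "'a measure" and \<mu> :: "real measure" and W :: "real set \<Rightarrow> 'a \<Rightarrow> complex"
  assumes finite_M: "finite_measure M" and finite_\<mu>: "finite_measure \<mu>"
    and orm: "orthogonal_random_measure M \<mu> W"
begin

lemma W_square_integrable: "A \<in> sets \<mu> \<Longrightarrow> W A \<in> square_integrable M"
  and W_norm: "A \<in> sets \<mu> \<Longrightarrow> (l2norm M (W A))\<^sup>2 = measure \<mu> A"
  and W_Un: "\<lbrakk>A \<in> sets \<mu>; A' \<in> sets \<mu>; A \<inter> A' = {}\<rbrakk> \<Longrightarrow> AE x in M. W (A \<union> A') x = W A x + W A' x"
  and W_orthogonal:
    "\<lbrakk>A \<in> sets \<mu>; A' \<in> sets \<mu>; A \<inter> A' = {}\<rbrakk> \<Longrightarrow> (\<integral>x. W A x * cnj (W A' x) \<partial>M) = 0"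
  using orm by (auto simp: orthogonal_random_measure_def l2norm_power2)

text \<open>
  The empty set has measure zero under \<open>\<mu>\<close>, so the isometry makes its random measure vanish; the rest is
  pairwise additivity.
\<close>
lemma W_UN:
  assumes "finite I" and "\<And>i. i \<in> I \<Longrightarrow> A i \<in> sets \<mu>" and "disjoint_family_on A I"
  shows "AE x in M. W (\<Union>i\<in>I. A i) x = (\<Sum>i\<in>I. W (A i) x)"
  using assms
proof (induction I)
  case empty
  have "l2norm M (W {}) = 0"
    using W_norm[of "{}"] by simp
  then show ?case
    using W_square_integrable[of "{}"] by (simp add: l2norm_eq_0_iff)
next
  case (insert i I)
  have "A i \<inter> (\<Union>j\<in>I. A j) = {}"
    using insert by (auto simp: disjoint_family_on_def)
  then have "AE x in M. W (A i \<union> (\<Union>j\<in>I. A j)) x = W (A i) x + W (\<Union>j\<in>I. A j) x"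
    using insert by (intro W_Un) auto
  moreover have "AE x in M. W (\<Union>j\<in>I. A j) x = (\<Sum>j\<in>I. W (A j) x)"
    using insert by (auto simp: disjoint_family_on_def)
  ultimately show ?case
    by eventually_elim (use insert in simp)
qed

text \<open>
  The integral of a simple function is defined over its level sets, but it may be computed over any
  finer finite partition: distinct values of \<open>p\<close> on which \<open>g\<close> agrees are merged by additivity of \<open>W\<close>.
  Two simple functions thereby get a common partition, which is the reason for linearity.
\<close>
lemma simple_integral_refine:
  assumes p: "simple_function \<mu> p"
  shows "AE x in M. simple_stoch_integral \<mu> W (\<lambda>u. g (p u)) x
                      = (\<Sum>y\<in>p ` space \<mu>. g y * W (p -` {y} \<inter> space \<mu>) x)"
proof -
  let ?S = "p ` space \<mu>"
  let ?P = "\<lambda>y. p -` {y} \<inter> space \<mu>"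
  let ?F = "\<lambda>z. {y \<in> ?S. g y = z}"
  have fin: "finite ?S"
    using p by (rule simple_functionD)
  have meas: "?P y \<in> sets \<mu>" for y
    using p by (rule simple_functionD)
  have "AE x in M. \<forall>z\<in>g ` ?S. W (\<Union>y\<in>?F z. ?P y) x = (\<Sum>y\<in>?F z. W (?P y) x)"
    by (intro AE_finite_allI W_UN) (use fin meas in \<open>auto simp: disjoint_family_on_def\<close>)
  then show ?thesis
  proof eventually_elim
    fix x assume *: "\<forall>z\<in>g ` ?S. W (\<Union>y\<in>?F z. ?P y) x = (\<Sum>y\<in>?F z. W (?P y) x)"
    have level: "(\<lambda>u. g (p u)) -` {z} \<inter> space \<mu> = (\<Union>y\<in>?F z. ?P y)" for z
      by auto
    have "simple_stoch_integral \<mu> W (\<lambda>u. g (p u)) x = (\<Sum>z\<in>g ` ?S. z * (\<Sum>y\<in>?F z. W (?P y) x))"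
      unfolding simple_stoch_integral_def level
      using * by (intro sum.cong) (auto simp: image_image)
    also have "\<dots> = (\<Sum>z\<in>g ` ?S. \<Sum>y\<in>?F z. g y * W (?P y) x)"
      by (simp add: sum_distrib_left)
    also have "\<dots> = (\<Sum>y\<in>?S. g y * W (?P y) x)"
      by (rule sum.image_gen[OF fin, symmetric])
    finally show "simple_stoch_integral \<mu> W (\<lambda>u. g (p u)) x = (\<Sum>y\<in>?S. g y * W (?P y) x)" .
  qed
qed

lemma simple_integral_lincomb:
  assumes s: "simple_function \<mu> s" and t: "simple_function \<mu> t"
  shows "AE x in M. simple_stoch_integral \<mu> W (\<lambda>u. a * s u + b * t u) x
           = a * simple_stoch_integral \<mu> W s x + b * simple_stoch_integral \<mu> W t x"
proof -
  \<comment> \<open>The level sets of the pair form the common refinement of the two partitions.\<close>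
  define p where "p u = (s u, t u)" for u
  have p: "simple_function \<mu> p"
    unfolding p_def using s t by (rule simple_function_Pair)
  from simple_integral_refine[OF p, of "\<lambda>(v, w). a * v + b * w"]
    simple_integral_refine[OF p, of fst] simple_integral_refine[OF p, of snd]
  show ?thesis
    by eventually_elim
       (simp add: p_def case_prod_beta sum_distrib_left sum.distrib[symmetric] algebra_simps)
qed

lemma simple_integral_square_integrable:
  assumes "simple_function \<mu> s"
  shows "simple_stoch_integral \<mu> W s \<in> square_integrable M"
  unfolding simple_stoch_integral_def[abs_def]
  by (intro square_integrable_sum square_integrable_cmult W_square_integrable simple_functionD[OF assms])

lemma simple_function_square_integrable:
  assumes "simple_function \<mu> s"
  shows "s \<in> square_integrable \<mu>"
proof (rule square_integrable_bounded[OF finite_\<mu>])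
  show "s \<in> borel_measurable \<mu>"
    using assms by (rule borel_measurable_simple_function)
  show "cmod (s u) \<le> Max (cmod ` s ` space \<mu>)" if "u \<in> space \<mu>" for u
    using that assms by (intro Max_ge) (auto intro: simple_functionD)
qed

lemma simple_integral_isometry:
  assumes s: "simple_function \<mu> s"
  shows "l2norm M (simple_stoch_integral \<mu> W s) = l2norm \<mu> s"
proof -
  interpret finite_measure \<mu> by (rule finite_\<mu>)
  let ?S = "s ` space \<mu>"
  let ?P = "\<lambda>y. s -` {y} \<inter> space \<mu>"
  have fin: "finite ?S"
    using s by (rule simple_functionD)
  have meas: "?P y \<in> sets \<mu>" for y
    using s by (rule simple_functionD)
  have "(l2norm M (simple_stoch_integral \<mu> W s))\<^sup>2 = (\<Sum>y\<in>?S. (l2norm M (\<lambda>x. y * W (?P y) x))\<^sup>2)"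
    unfolding simple_stoch_integral_def[abs_def]
  proof (rule l2norm_sum_orthogonal[OF fin])
    fix y z :: complex assume "y \<noteq> z"
    then have "(\<integral>x. W (?P y) x * cnj (W (?P z) x) \<partial>M) = 0"
      by (intro W_orthogonal meas) auto
    then have "(\<integral>x. (y * cnj z) * (W (?P y) x * cnj (W (?P z) x)) \<partial>M) = 0"
      by simp
    then show "(\<integral>x. (y * W (?P y) x) * cnj (z * W (?P z) x) \<partial>M) = 0"
      by (simp add: mult_ac)
  qed (intro square_integrable_cmult W_square_integrable meas)
  also have "\<dots> = (\<Sum>y\<in>?S. (cmod y)\<^sup>2 * measure \<mu> (?P y))"
    by (simp add: power_mult_distrib W_norm meas)
  also have "\<dots> = (\<integral>u. (\<Sum>y\<in>?S. (cmod y)\<^sup>2 * indicator (?P y) u) \<partial>\<mu>)"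
  proof (subst Bochner_Integration.integral_sum)
    have "integrable \<mu> (indicat_real (?P y))" for y
      by (rule integrable_real_indicator) (simp_all add: meas emeasure_finite less_top[symmetric])
    then show "integrable \<mu> (\<lambda>u. (cmod y)\<^sup>2 * indicat_real (?P y) u)" for y
      by simp
  qed (simp add: measure_def meas)
  also have "\<dots> = (\<integral>u. (cmod (s u))\<^sup>2 \<partial>\<mu>)"
  proof (rule Bochner_Integration.integral_cong)
    fix u assume u: "u \<in> space \<mu>"
    have "(\<Sum>y\<in>?S. (cmod y)\<^sup>2 * indicator (?P y) u) = (\<Sum>y\<in>?S. if y = s u then (cmod y)\<^sup>2 else 0)"
      using u by (intro sum.cong) (auto simp: indicator_def)
    then show "(\<Sum>y\<in>?S. (cmod y)\<^sup>2 * indicator (?P y) u) = (cmod (s u))\<^sup>2"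
      using u fin by simp
  qed simp
  finally show ?thesis
    by (simp add: l2norm_power2[symmetric])
qed

lemma simple_integral_dist:
  assumes s: "simple_function \<mu> s" and t: "simple_function \<mu> t"
  shows "l2norm M (\<lambda>x. simple_stoch_integral \<mu> W s x - simple_stoch_integral \<mu> W t x)
           = l2norm \<mu> (\<lambda>u. s u - t u)"
proof -
  have st: "simple_function \<mu> (\<lambda>u. s u - t u)"
    using s t by (rule simple_function_diff)
  have "l2norm M (\<lambda>x. simple_stoch_integral \<mu> W s x - simple_stoch_integral \<mu> W t x)
          = l2norm M (simple_stoch_integral \<mu> W (\<lambda>u. s u - t u))"
    using simple_integral_lincomb[OF s t, of 1 "-1"]
    by (intro l2norm_cong_AE square_integrable_measurable square_integrable_diff
        simple_integral_square_integrable s t st) (auto elim: eventually_mono)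
  then show ?thesis
    by (simp add: simple_integral_isometry st)
qed

text \<open>
  The stochastic integral is the closure of the graph of the integral of simple functions. In this
  form its closedness and linearity reduce to estimates.
\<close>
lemma has_stoch_integral_iff:
  "has_stoch_integral M \<mu> W \<phi> \<xi> \<longleftrightarrow> \<phi> \<in> square_integrable \<mu> \<and> \<xi> \<in> square_integrable M \<and>
     (\<forall>e>0. \<exists>s. simple_function \<mu> s \<and> l2norm \<mu> (\<lambda>u. \<phi> u - s u) < e \<and>
        l2norm M (\<lambda>x. \<xi> x - simple_stoch_integral \<mu> W s x) < e)"
    (is "?lhs \<longleftrightarrow> _ \<and> _ \<and> ?approx")
proof (intro iffI conjI)
  assume L: ?lhs
  then show "\<phi> \<in> square_integrable \<mu>" "\<xi> \<in> square_integrable M"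
    by (simp_all add: has_stoch_integral_def)
  from L obtain s where s: "\<And>n. simple_function \<mu> (s n)"
    and lim: "(\<lambda>n. \<integral>u. (cmod (\<phi> u - s n u))\<^sup>2 \<partial>\<mu>) \<longlonglongrightarrow> 0"
      "(\<lambda>n. \<integral>x. (cmod (\<xi> x - simple_stoch_integral \<mu> W (s n) x))\<^sup>2 \<partial>M) \<longlonglongrightarrow> 0"
    by (auto simp: has_stoch_integral_def)
  have lim': "(\<lambda>n. l2norm \<mu> (\<lambda>u. \<phi> u - s n u)) \<longlonglongrightarrow> 0"
      "(\<lambda>n. l2norm M (\<lambda>x. \<xi> x - simple_stoch_integral \<mu> W (s n) x)) \<longlonglongrightarrow> 0"
    using lim[THEN tendsto_real_sqrt] by (simp_all add: l2norm_def)
  show ?approx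
  proof (intro allI impI)
    fix e :: real assume "e > 0"
    from eventually_happens'[OF sequentially_bot
        eventually_conj[OF order_tendstoD(2)[OF lim'(1) this] order_tendstoD(2)[OF lim'(2) this]]]
    show "\<exists>s. simple_function \<mu> s \<and> l2norm \<mu> (\<lambda>u. \<phi> u - s u) < e \<and>
        l2norm M (\<lambda>x. \<xi> x - simple_stoch_integral \<mu> W s x) < e"
      using s by blast
  qed
next
  assume R: "\<phi> \<in> square_integrable \<mu> \<and> \<xi> \<in> square_integrable M \<and> ?approx"
  have "\<exists>s. \<forall>n. simple_function \<mu> (s n) \<and> l2norm \<mu> (\<lambda>u. \<phi> u - s n u) < 1 / Suc n \<and>
      l2norm M (\<lambda>x. \<xi> x - simple_stoch_integral \<mu> W (s n) x) < 1 / Suc n"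
  proof (rule choice, rule allI)
    fix n :: nat
    have "(0::real) < 1 / Suc n" by simp
    with R show "\<exists>s. simple_function \<mu> s \<and> l2norm \<mu> (\<lambda>u. \<phi> u - s u) < 1 / Suc n \<and>
        l2norm M (\<lambda>x. \<xi> x - simple_stoch_integral \<mu> W s x) < 1 / Suc n"
      by blast
  qed
  then obtain s where s: "\<And>n. simple_function \<mu> (s n)"
    and le: "\<And>n. l2norm \<mu> (\<lambda>u. \<phi> u - s n u) < 1 / Suc n"
      "\<And>n. l2norm M (\<lambda>x. \<xi> x - simple_stoch_integral \<mu> W (s n) x) < 1 / Suc n"
    by blast
  have *: "(\<lambda>n. (a n)\<^sup>2) \<longlonglongrightarrow> 0" if "\<And>n. 0 \<le> a n" "\<And>n. a n < 1 / Suc n" for a :: "nat \<Rightarrow> real"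
  proof -
    have "a \<longlonglongrightarrow> 0"
      by (rule tendsto_sandwich[OF _ _ tendsto_const LIMSEQ_Suc[OF lim_1_over_n]])
         (use that in \<open>auto intro!: eventuallyI less_imp_le\<close>)
    from tendsto_power[OF this, of 2] show ?thesis by simp
  qed
  show ?lhs
    using R s *[OF l2norm_nonneg le(1)] *[OF l2norm_nonneg le(2)]
    by (auto simp: has_stoch_integral_def l2norm_power2)
qed

lemma has_stoch_integral_square_integrable:
  assumes "has_stoch_integral M \<mu> W \<phi> \<xi>"
  shows "\<phi> \<in> square_integrable \<mu>" "\<xi> \<in> square_integrable M"
  using assms by (simp_all add: has_stoch_integral_def)

lemma has_stoch_integral_isometry:
  assumes "has_stoch_integral M \<mu> W \<phi> \<xi>"
  shows "l2norm M \<xi> = l2norm \<mu> \<phi>"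
proof -
  note sq = has_stoch_integral_square_integrable[OF assms]
  have "\<bar>l2norm M \<xi> - l2norm \<mu> \<phi>\<bar> \<le> 0"
  proof (rule field_le_epsilon)
    fix e :: real assume "e > 0"
    then have "e / 2 > 0" by simp
    then obtain s where s: "simple_function \<mu> s" "l2norm \<mu> (\<lambda>u. \<phi> u - s u) < e / 2"
        "l2norm M (\<lambda>x. \<xi> x - simple_stoch_integral \<mu> W s x) < e / 2"
      using assms unfolding has_stoch_integral_iff by blast
    show "\<bar>l2norm M \<xi> - l2norm \<mu> \<phi>\<bar> \<le> 0 + e"
      using l2norm_reverse_triangle[OF sq(1) simple_function_square_integrable[OF s(1)]]
        l2norm_reverse_triangle[OF sq(2) simple_integral_square_integrable[OF s(1)]]
        simple_integral_isometry[OF s(1)] s(2,3) by linarith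
  qed
  then show ?thesis by simp
qed

lemma has_stoch_integral_lincomb:
  assumes "has_stoch_integral M \<mu> W \<phi> \<xi>" "has_stoch_integral M \<mu> W \<psi> \<eta>"
  shows "has_stoch_integral M \<mu> W (\<lambda>u. a * \<phi> u + b * \<psi> u) (\<lambda>x. a * \<xi> x + b * \<eta> x)"
  unfolding has_stoch_integral_iff
proof (intro conjI allI impI square_integrable_lincomb)
  note sq = has_stoch_integral_square_integrable[OF assms(1)]
    has_stoch_integral_square_integrable[OF assms(2)]
  fix e :: real assume "e > 0"
  obtain d where "d > 0"
    and de: "\<And>p q. p < d \<Longrightarrow> q < d \<Longrightarrow> cmod a * p + cmod b * q < e"
    using lincomb_tolerance[OF norm_ge_zero norm_ge_zero \<open>e > 0\<close>] by metis
  obtain s where s: "simple_function \<mu> s" "l2norm \<mu> (\<lambda>u. \<phi> u - s u) < d"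
      "l2norm M (\<lambda>x. \<xi> x - simple_stoch_integral \<mu> W s x) < d"
    using assms(1) \<open>d > 0\<close> unfolding has_stoch_integral_iff by blast
  obtain t where t: "simple_function \<mu> t" "l2norm \<mu> (\<lambda>u. \<psi> u - t u) < d"
      "l2norm M (\<lambda>x. \<eta> x - simple_stoch_integral \<mu> W t x) < d"
    using assms(2) \<open>d > 0\<close> unfolding has_stoch_integral_iff by blast
  let ?I = "simple_stoch_integral \<mu> W"
  let ?r = "\<lambda>u. a * s u + b * t u"
  note s' = simple_function_square_integrable[OF s(1)] simple_integral_square_integrable[OF s(1)]
  note t' = simple_function_square_integrable[OF t(1)] simple_integral_square_integrable[OF t(1)]
  have r: "simple_function \<mu> ?r"
    using s(1) t(1) by (rule simple_function_compose2)
  have "l2norm \<mu> (\<lambda>u. (a * \<phi> u + b * \<psi> u) - ?r u) < e"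
    using l2norm_lincomb_diff[OF sq(1,3) s'(1) t'(1), of a b] de[OF s(2) t(2)] by linarith
  moreover have "l2norm M (\<lambda>x. (a * \<xi> x + b * \<eta> x) - ?I ?r x)
      = l2norm M (\<lambda>x. (a * \<xi> x + b * \<eta> x) - (a * ?I s x + b * ?I t x))"
    using simple_integral_lincomb[OF s(1) t(1), of a b]
    by (intro l2norm_cong_AE square_integrable_measurable square_integrable_diff
        square_integrable_lincomb sq s' t' simple_integral_square_integrable r)
       (auto elim: eventually_mono)
  moreover have "\<dots> < e"
    using l2norm_lincomb_diff[OF sq(2,4) s'(2) t'(2), of a b] de[OF s(3) t(3)] by linarith
  ultimately show "\<exists>s. simple_function \<mu> s \<and> l2norm \<mu> (\<lambda>u. (a * \<phi> u + b * \<psi> u) - s u) < e \<and>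
      l2norm M (\<lambda>x. (a * \<xi> x + b * \<eta> x) - ?I s x) < e"
    using r by (intro exI[of _ ?r]) simp
qed (use assms in \<open>auto dest: has_stoch_integral_square_integrable\<close>)

lemma has_stoch_integral_diff:
  assumes "has_stoch_integral M \<mu> W \<phi> \<xi>" "has_stoch_integral M \<mu> W \<psi> \<eta>"
  shows "has_stoch_integral M \<mu> W (\<lambda>u. \<phi> u - \<psi> u) (\<lambda>x. \<xi> x - \<eta> x)"
  using has_stoch_integral_lincomb[OF assms, of 1 "-1"] by simp

lemma has_stoch_integral_dist:
  assumes "has_stoch_integral M \<mu> W \<phi> \<xi>" "has_stoch_integral M \<mu> W \<psi> \<eta>"
  shows "l2norm M (\<lambda>x. \<xi> x - \<eta> x) = l2norm \<mu> (\<lambda>u. \<phi> u - \<psi> u)"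
  by (rule has_stoch_integral_isometry[OF has_stoch_integral_diff[OF assms]])

text \<open>
  Being isometric, the integral is injective and single-valued up to null sets; the arbitrary choices
  of a stochastic integral and of a spectral representation are therefore harmless.
\<close>
lemma has_stoch_integral_AE_iff:
  assumes "has_stoch_integral M \<mu> W \<phi> \<xi>" "has_stoch_integral M \<mu> W \<psi> \<eta>"
  shows "(AE x in M. \<xi> x = \<eta> x) \<longleftrightarrow> (AE u in \<mu>. \<phi> u = \<psi> u)"
  using has_stoch_integral_dist[OF assms]
    l2norm_eq_0_iff[OF has_stoch_integral_square_integrable(1)[OF has_stoch_integral_diff[OF assms]]]
    l2norm_eq_0_iff[OF has_stoch_integral_square_integrable(2)[OF has_stoch_integral_diff[OF assms]]]
  by simp

lemma has_stoch_integral_limit: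
  assumes \<phi>: "\<phi> \<in> square_integrable \<mu>" and \<xi>: "\<xi> \<in> square_integrable M"
    and approx: "\<And>e. e > 0 \<Longrightarrow> \<exists>\<psi> \<eta>. has_stoch_integral M \<mu> W \<psi> \<eta> \<and>
      l2norm \<mu> (\<lambda>u. \<phi> u - \<psi> u) < e \<and> l2norm M (\<lambda>x. \<xi> x - \<eta> x) < e"
  shows "has_stoch_integral M \<mu> W \<phi> \<xi>"
  unfolding has_stoch_integral_iff
proof (intro conjI allI impI \<phi> \<xi>)
  fix e :: real assume "e > 0"
  then have e: "e / 2 > 0" by simp
  from approx[OF e] obtain \<psi> \<eta> where h: "has_stoch_integral M \<mu> W \<psi> \<eta>"
    and 1: "l2norm \<mu> (\<lambda>u. \<phi> u - \<psi> u) < e / 2" "l2norm M (\<lambda>x. \<xi> x - \<eta> x) < e / 2"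
    by blast
  note sq = has_stoch_integral_square_integrable[OF h]
  from h e obtain s where s: "simple_function \<mu> s" "l2norm \<mu> (\<lambda>u. \<psi> u - s u) < e / 2"
      "l2norm M (\<lambda>x. \<eta> x - simple_stoch_integral \<mu> W s x) < e / 2"
    unfolding has_stoch_integral_iff by blast
  show "\<exists>s. simple_function \<mu> s \<and> l2norm \<mu> (\<lambda>u. \<phi> u - s u) < e \<and>
      l2norm M (\<lambda>x. \<xi> x - simple_stoch_integral \<mu> W s x) < e"
    using l2norm_diff_triangle[OF \<phi> sq(1) simple_function_square_integrable[OF s(1)]]
      l2norm_diff_triangle[OF \<xi> sq(2) simple_integral_square_integrable[OF s(1)]] 1 s
    by (intro exI[of _ s]) linarith
qed

lemma has_stoch_integral_simple:
  assumes "simple_function \<mu> s"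
  shows "has_stoch_integral M \<mu> W s (simple_stoch_integral \<mu> W s)"
  unfolding has_stoch_integral_iff
  using assms simple_function_square_integrable simple_integral_square_integrable
  by (auto intro!: exI[of _ s] simp: l2norm_def)

text \<open>
  The integrals of approximating simple functions are Cauchy by isometry and converge by completeness.
\<close>
lemma has_stoch_integral_exists:
  assumes \<phi>: "\<phi> \<in> square_integrable \<mu>"
  shows "\<exists>\<xi>. has_stoch_integral M \<mu> W \<phi> \<xi>"
proof -
  let ?I = "simple_stoch_integral \<mu> W"
  obtain s where s: "\<And>n. simple_function \<mu> (s n)"
    and s\<phi>: "(\<lambda>n. l2norm \<mu> (\<lambda>u. \<phi> u - s n u)) \<longlonglongrightarrow> 0"
    using square_integrable_simple_approx[OF \<phi>] by blast
  note s' = simple_function_square_integrable[OF s] simple_integral_square_integrable[OF s]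
  obtain \<xi> where \<xi>: "\<xi> \<in> square_integrable M" "(\<lambda>n. l2norm M (\<lambda>x. \<xi> x - ?I (s n) x)) \<longlonglongrightarrow> 0"
  proof (rule l2_complete[OF finite_M, of "\<lambda>n. ?I (s n)"])
    fix e :: real assume "e > 0"
    from l2_Cauchy_of_convergent[OF \<phi> s'(1) s\<phi> this]
    show "\<exists>K. \<forall>m\<ge>K. \<forall>n\<ge>K. l2norm M (\<lambda>x. ?I (s m) x - ?I (s n) x) < e"
      by (simp add: simple_integral_dist s)
  qed (use s' in auto)
  have "has_stoch_integral M \<mu> W \<phi> \<xi>"
  proof (rule has_stoch_integral_limit[OF \<phi> \<xi>(1)])
    fix e :: real assume "e > 0"
    from eventually_happens'[OF sequentially_bot
        eventually_conj[OF order_tendstoD(2)[OF s\<phi> this] order_tendstoD(2)[OF \<xi>(2) this]]]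
    obtain n where "l2norm \<mu> (\<lambda>u. \<phi> u - s n u) < e" "l2norm M (\<lambda>x. \<xi> x - ?I (s n) x) < e"
      by blast
    with has_stoch_integral_simple[OF s[of n]]
    show "\<exists>\<psi> \<eta>. has_stoch_integral M \<mu> W \<psi> \<eta> \<and>
        l2norm \<mu> (\<lambda>u. \<phi> u - \<psi> u) < e \<and> l2norm M (\<lambda>x. \<xi> x - \<eta> x) < e"
      by blast
  qed
  then show ?thesis by blast
qed

end

section \<open>Linear spans and their closures\<close>

text \<open>
  The explicit finite sums match those in the definition of the closed span, so that a spectral
  representation and the variable that it represents can be approximated with the same coefficients.
\<close>
definition lin_span :: "'i set \<Rightarrow> ('i \<Rightarrow> 'a \<Rightarrow> complex) \<Rightarrow> ('a \<Rightarrow> complex) set" where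
  "lin_span I B = {f. \<exists>F c. finite F \<and> F \<subseteq> I \<and> f = (\<lambda>x. \<Sum>i\<in>F. c i * B i x)}"

lemma lin_span_zero: "(\<lambda>x. 0) \<in> lin_span I B"
  by (auto simp: lin_span_def intro!: exI[of _ "{}"])

lemma lin_span_base: "i \<in> I \<Longrightarrow> B i \<in> lin_span I B"
  by (auto simp: lin_span_def intro!: exI[of _ "{i}"] exI[of _ "\<lambda>_. 1"])

lemma lin_span_lincomb:
  assumes "f \<in> lin_span I B" "g \<in> lin_span I B"
  shows "(\<lambda>x. a * f x + b * g x) \<in> lin_span I B"
proof -
  from assms obtain F c G d where F: "finite F" "F \<subseteq> I" "f = (\<lambda>x. \<Sum>i\<in>F. c i * B i x)"
    and G: "finite G" "G \<subseteq> I" "g = (\<lambda>x. \<Sum>i\<in>G. d i * B i x)"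
    by (auto simp: lin_span_def)
  define c' where "c' i = (if i \<in> F then c i else 0)" for i
  define d' where "d' i = (if i \<in> G then d i else 0)" for i
  have "f x = (\<Sum>i\<in>F \<union> G. c' i * B i x)" for x
    unfolding F(3) using F(1) G(1) by (intro sum.mono_neutral_cong_left) (auto simp: c'_def)
  moreover have "g x = (\<Sum>i\<in>F \<union> G. d' i * B i x)" for x
    unfolding G(3) using F(1) G(1) by (intro sum.mono_neutral_cong_left) (auto simp: d'_def)
  ultimately have "(\<lambda>x. a * f x + b * g x) = (\<lambda>x. \<Sum>i\<in>F \<union> G. (a * c' i + b * d' i) * B i x)"
    by (simp add: sum_distrib_left sum.distrib algebra_simps)
  with F G show ?thesis
    unfolding lin_span_def
    by (intro CollectI exI[of _ "F \<union> G"] exI[of _ "\<lambda>i. a * c' i + b * d' i"]) auto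
qed

lemma lin_span_sum:
  assumes "\<And>j. j \<in> J \<Longrightarrow> f j \<in> lin_span I B"
  shows "(\<lambda>x. \<Sum>j\<in>J. c j * f j x) \<in> lin_span I B"
  using assms
proof (induction J rule: infinite_finite_induct)
  case (insert j J)
  then have "(\<lambda>x. c j * f j x + 1 * (\<Sum>j\<in>J. c j * f j x)) \<in> lin_span I B"
    by (intro lin_span_lincomb) auto
  with insert show ?case by simp
qed (auto intro: lin_span_zero)

lemma lin_span_square_integrable:
  assumes "\<And>i. i \<in> I \<Longrightarrow> B i \<in> square_integrable M" "f \<in> lin_span I B"
  shows "f \<in> square_integrable M"
  using assms(2)
  by (auto simp: lin_span_def subset_iff intro!: square_integrable_sum square_integrable_cmult assms(1))

lemma closed_span_iff:
  "f \<in> closed_span M \<Theta> B \<longleftrightarrow>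
     f \<in> square_integrable M \<and> (\<forall>e>0. \<exists>g\<in>lin_span \<Theta> B. l2norm M (\<lambda>x. f x - g x) < e)"
    (is "_ \<longleftrightarrow> _ \<and> ?approx")
proof (intro iffI conjI)
  assume f: "f \<in> closed_span M \<Theta> B"
  then show "f \<in> square_integrable M"
    by (simp add: closed_span_def)
  show ?approx
  proof (intro allI impI)
    fix e :: real assume "e > 0"
    then have "e\<^sup>2 > 0" by simp
    with f obtain F c where F: "finite F" "F \<subseteq> \<Theta>"
      "(\<integral>x. (cmod (f x - (\<Sum>t\<in>F. c t * B t x)))\<^sup>2 \<partial>M) < e\<^sup>2"
      unfolding closed_span_def by blast
    then have "l2norm M (\<lambda>x. f x - (\<Sum>t\<in>F. c t * B t x)) < e"
      unfolding l2norm_power2[symmetric] using \<open>e > 0\<close> power2_less_imp_less by fastforce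
    then show "\<exists>g\<in>lin_span \<Theta> B. l2norm M (\<lambda>x. f x - g x) < e"
      using F by (intro bexI[of _ "\<lambda>x. \<Sum>t\<in>F. c t * B t x"]) (auto simp: lin_span_def)
  qed
next
  assume R: "f \<in> square_integrable M \<and> ?approx"
  show "f \<in> closed_span M \<Theta> B"
    unfolding closed_span_def
  proof (intro CollectI conjI allI impI)
    fix e :: real assume "e > 0"
    then have "sqrt e > 0" by simp
    with R obtain g where g: "g \<in> lin_span \<Theta> B" "l2norm M (\<lambda>x. f x - g x) < sqrt e"
      by blast
    then have "(\<integral>x. (cmod (f x - g x))\<^sup>2 \<partial>M) < e"
      unfolding l2norm_def by simp
    with g show "\<exists>F c. finite F \<and> F \<subseteq> \<Theta> \<and> (\<integral>x. (cmod (f x - (\<Sum>t\<in>F. c t * B t x)))\<^sup>2 \<partial>M) < e"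
      unfolding lin_span_def by blast
  qed (use R in simp)
qed

lemma closed_span_lincomb:
  assumes B: "\<And>t. t \<in> \<Theta> \<Longrightarrow> B t \<in> square_integrable M"
    and f: "f \<in> closed_span M \<Theta> B" and g: "g \<in> closed_span M \<Theta> B"
  shows "(\<lambda>x. a * f x + b * g x) \<in> closed_span M \<Theta> B"
  unfolding closed_span_iff
proof (intro conjI allI impI)
  have span_sq: "h \<in> square_integrable M" if "h \<in> lin_span \<Theta> B" for h
    using lin_span_square_integrable[of \<Theta> B M h] B that by blast
  have sq: "f \<in> square_integrable M" "g \<in> square_integrable M"
    using f g by (simp_all add: closed_span_iff)
  then show "(\<lambda>x. a * f x + b * g x) \<in> square_integrable M"
    by (rule square_integrable_lincomb)
  fix e :: real assume "e > 0"
  obtain d where "d > 0"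
    and de: "\<And>p q. p < d \<Longrightarrow> q < d \<Longrightarrow> cmod a * p + cmod b * q < e"
    using lincomb_tolerance[OF norm_ge_zero norm_ge_zero \<open>e > 0\<close>] by metis
  obtain f' where f': "f' \<in> lin_span \<Theta> B" "l2norm M (\<lambda>x. f x - f' x) < d"
    using f \<open>d > 0\<close> unfolding closed_span_iff by blast
  obtain g' where g': "g' \<in> lin_span \<Theta> B" "l2norm M (\<lambda>x. g x - g' x) < d"
    using g \<open>d > 0\<close> unfolding closed_span_iff by blast
  have "l2norm M (\<lambda>x. (a * f x + b * g x) - (a * f' x + b * g' x))
      \<le> cmod a * l2norm M (\<lambda>x. f x - f' x) + cmod b * l2norm M (\<lambda>x. g x - g' x)"
    by (intro l2norm_lincomb_diff sq span_sq f'(1) g'(1))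
  also have "\<dots> < e"
    by (rule de[OF f'(2) g'(2)])
  finally show "\<exists>h\<in>lin_span \<Theta> B. l2norm M (\<lambda>x. (a * f x + b * g x) - h x) < e"
    by (intro bexI[of _ "\<lambda>x. a * f' x + b * g' x"] lin_span_lincomb f'(1) g'(1))
qed

lemma closed_span_limit:
  assumes B: "\<And>t. t \<in> \<Theta> \<Longrightarrow> B t \<in> square_integrable M"
    and f: "f \<in> square_integrable M"
    and approx: "\<And>e. e > 0 \<Longrightarrow> \<exists>g\<in>closed_span M \<Theta> B. l2norm M (\<lambda>x. f x - g x) < e"
  shows "f \<in> closed_span M \<Theta> B"
  unfolding closed_span_iff
proof (intro conjI allI impI f)
  fix e :: real assume "e > 0"
  then have "e / 2 > 0" by simp
  from approx[OF this] obtain g where g: "g \<in> closed_span M \<Theta> B" "l2norm M (\<lambda>x. f x - g x) < e / 2"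
    by blast
  from g(1) \<open>e / 2 > 0\<close> obtain h where h: "h \<in> lin_span \<Theta> B" "l2norm M (\<lambda>x. g x - h x) < e / 2"
    unfolding closed_span_iff by blast
  have "l2norm M (\<lambda>x. f x - h x) \<le> l2norm M (\<lambda>x. f x - g x) + l2norm M (\<lambda>x. g x - h x)"
    using g(1) h(1) lin_span_square_integrable[of \<Theta> B M h] B
    by (intro l2norm_diff_triangle f) (auto simp: closed_span_iff)
  with g h show "\<exists>h\<in>lin_span \<Theta> B. l2norm M (\<lambda>x. f x - h x) < e"
    by (intro bexI[of _ h]) auto
qed

lemma closed_span_sum:
  assumes B: "\<And>t. t \<in> \<Theta> \<Longrightarrow> B t \<in> square_integrable M"
    and "\<And>j. j \<in> J \<Longrightarrow> f j \<in> closed_span M \<Theta> B"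
  shows "(\<lambda>x. \<Sum>j\<in>J. c j * f j x) \<in> closed_span M \<Theta> B"
  using assms(2)
proof (induction J rule: infinite_finite_induct)
  case (insert j J)
  then have "(\<lambda>x. c j * f j x + 1 * (\<Sum>j\<in>J. c j * f j x)) \<in> closed_span M \<Theta> B"
    by (intro closed_span_lincomb B) auto
  with insert show ?case by simp
qed (auto simp: closed_span_iff square_integrable_zero l2norm_def intro!: bexI[OF _ lin_span_zero])

text \<open>
  The form in which indicators are reached below: on a finite measure space, bounded pointwise limits
  are limits in \<open>L\<^sub>2\<close>.
\<close>
lemma closed_span_bounded_limit:
  assumes M: "finite_measure M" and B: "\<And>t. t \<in> \<Theta> \<Longrightarrow> B t \<in> square_integrable M"
    and s: "\<And>n. s n \<in> closed_span M \<Theta> B"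
    and bound: "\<And>n x. x \<in> space M \<Longrightarrow> cmod (s n x) \<le> K"
    and lim: "\<And>x. x \<in> space M \<Longrightarrow> (\<lambda>n. s n x) \<longlonglongrightarrow> f x"
  shows "f \<in> closed_span M \<Theta> B"
proof -
  have s_meas: "s n \<in> borel_measurable M" for n
    using s by (auto simp: closed_span_iff square_integrable_def)
  have f_meas: "f \<in> borel_measurable M"
    by (rule borel_measurable_LIMSEQ_metric[OF s_meas lim])
  have f_bound: "cmod (f x) \<le> K" if "x \<in> space M" for x
    by (rule Lim_norm_ubound[OF _ lim[OF that]]) (use bound that in auto)
  have f: "f \<in> square_integrable M"
    by (rule square_integrable_bounded[OF M f_meas f_bound])
  have l2lim: "(\<lambda>n. l2norm M (\<lambda>x. f x - s n x)) \<longlonglongrightarrow> 0"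
  proof (rule l2norm_dominated_convergence[OF s_meas f_meas _ lim])
    show "(\<lambda>x. complex_of_real (2 * K)) \<in> square_integrable M"
      by (rule square_integrable_bounded[OF M _ order_refl]) simp
    show "cmod (f x - s n x) \<le> cmod (complex_of_real (2 * K))" if "x \<in> space M" for n x
      using norm_triangle_ineq4[of "f x" "s n x"] f_bound[OF that] bound[OF that, of n]
      by (simp only: norm_of_real)
  qed
  show ?thesis
  proof (rule closed_span_limit[OF B f])
    fix e :: real assume "e > 0"
    from eventually_happens'[OF sequentially_bot order_tendstoD(2)[OF l2lim this]] s
    show "\<exists>g\<in>closed_span M \<Theta> B. l2norm M (\<lambda>x. f x - g x) < e" by blast
  qed
qed

lemma closed_span_cong:
  assumes "f \<in> closed_span M \<Theta> B" and "\<And>x. x \<in> space M \<Longrightarrow> f x = g x"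
  shows "g \<in> closed_span M \<Theta> B"
proof -
  have "integrable M (\<lambda>x. (cmod (f x))\<^sup>2) = integrable M (\<lambda>x. (cmod (g x))\<^sup>2)"
    using assms(2) by (intro Bochner_Integration.integrable_cong) auto
  moreover have "f \<in> borel_measurable M \<longleftrightarrow> g \<in> borel_measurable M"
    using assms(2) by (rule measurable_cong)
  moreover have "l2norm M (\<lambda>x. f x - h x) = l2norm M (\<lambda>x. g x - h x)" for h
    unfolding l2norm_def using assms(2)
    by (intro arg_cong[where f = sqrt] Bochner_Integration.integral_cong) auto
  ultimately show ?thesis
    using assms(1) by (simp add: closed_span_iff square_integrable_def)
qed

section \<open>Density of the harmonics\<close>

definition harmonic :: "real \<Rightarrow> real \<Rightarrow> complex" where
  "harmonic t u = iexp (t * u)"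

lemma harmonic_eq_cis: "harmonic t u = cis (t * u)"
  by (simp add: harmonic_def cis_conv_exp)

lemma norm_harmonic [simp]: "cmod (harmonic t u) = 1"
  by (simp add: harmonic_eq_cis)

lemma harmonic_zero: "harmonic 0 = (\<lambda>u. 1)"
  by (auto simp: harmonic_def)

text \<open>
  Trigonometric polynomials with times in an additive set form an algebra, since
  \<open>e\<^sup>i\<^sup>s\<^sup>u e\<^sup>i\<^sup>t\<^sup>u = e\<^sup>i\<^sup>(\<^sup>s\<^sup>+\<^sup>t\<^sup>)\<^sup>u\<close>.
\<close>
lemma harmonic_span_mult:
  assumes \<Theta>: "\<And>s t. s \<in> \<Theta> \<Longrightarrow> t \<in> \<Theta> \<Longrightarrow> s + t \<in> \<Theta>"
    and f: "f \<in> lin_span \<Theta> harmonic" and g: "g \<in> lin_span \<Theta> harmonic"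
  shows "(\<lambda>u. f u * g u) \<in> lin_span \<Theta> harmonic"
proof -
  from f g obtain F c G d where F: "F \<subseteq> \<Theta>" "f = (\<lambda>u. \<Sum>s\<in>F. c s * harmonic s u)"
    and G: "G \<subseteq> \<Theta>" "g = (\<lambda>u. \<Sum>t\<in>G. d t * harmonic t u)"
    by (auto simp: lin_span_def)
  have "f u * g u = (\<Sum>s\<in>F. c s * (\<Sum>t\<in>G. d t * harmonic (s + t) u))" for u
  proof -
    have "harmonic (s + t) u = harmonic s u * harmonic t u" for s t
      by (simp add: harmonic_eq_cis cis_mult distrib_right)
    then show ?thesis
      unfolding F(2) G(2) sum_product by (simp add: sum_distrib_left mult_ac)
  qed
  moreover have "(\<lambda>u. \<Sum>s\<in>F. c s * (\<Sum>t\<in>G. d t * harmonic (s + t) u)) \<in> lin_span \<Theta> harmonic"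
    using F G by (intro lin_span_sum lin_span_base \<Theta>) auto
  ultimately show ?thesis by simp
qed

text \<open>
  On the unit circle the real and imaginary parts are combinations of \<open>z\<close> and of its inverse, hence a
  real polynomial in them becomes a trigonometric polynomial along \<open>u \<mapsto> e\<^sup>i\<^sup>c\<^sup>u\<close>.
\<close>
lemma polynomial_on_circle_in_harmonic_span:
  assumes \<Theta>: "0 \<in> \<Theta>" "\<And>s t. s \<in> \<Theta> \<Longrightarrow> t \<in> \<Theta> \<Longrightarrow> s + t \<in> \<Theta>" "c \<in> \<Theta>" "- c \<in> \<Theta>"
    and p: "real_polynomial_function p"
  shows "(\<lambda>u. complex_of_real (p (cis (c * u)))) \<in> lin_span \<Theta> harmonic"
  using p
proof induction
  case (linear p)
  have p_eq: "p z = Re z * p 1 + Im z * p \<i>" for z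
  proof -
    have "p z = p (Re z *\<^sub>R 1 + Im z *\<^sub>R \<i>)"
      by (intro arg_cong[where f = p]) (simp add: complex_eq_iff)
    then show ?thesis
      using linear by (simp add: linear_simps)
  qed
  have "complex_of_real (p (cis (c * u)))
      = (p 1 / 2 - \<i> * p \<i> / 2) * harmonic c u + (p 1 / 2 + \<i> * p \<i> / 2) * harmonic (- c) u" for u
    unfolding p_eq[of "cis (c * u)"] by (simp add: harmonic_eq_cis complex_eq_iff)
  with \<Theta> show ?case
    by (simp add: lin_span_lincomb lin_span_base)
next
  case (const a)
  have "(\<lambda>u. a * harmonic 0 u + 0 * harmonic 0 u) \<in> lin_span \<Theta> harmonic"
    using \<Theta> by (intro lin_span_lincomb lin_span_base)
  then show ?case by (simp add: harmonic_zero)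
next
  case (add p q)
  from lin_span_lincomb[OF add.IH, of 1 1] show ?case by simp
next
  case (mult p q)
  from harmonic_span_mult[OF \<Theta>(2) mult.IH] show ?case by simp
qed

text \<open>
  The times form an additive subgroup of the reals, so that products and conjugates of harmonics are
  harmonics again; the integers and the whole line are the two cases of interest.
\<close>
locale harmonic_L2 =
  fixes \<mu> :: "real measure" and \<Omega> \<Theta> :: "real set"
  assumes finite_\<mu>: "finite_measure \<mu>" and sets_\<mu>: "sets \<mu> = sets (restrict_space borel \<Omega>)"
    and zero_in: "0 \<in> \<Theta>" and add_in: "\<And>s t. s \<in> \<Theta> \<Longrightarrow> t \<in> \<Theta> \<Longrightarrow> s + t \<in> \<Theta>"
    and minus_in: "\<And>t. t \<in> \<Theta> \<Longrightarrow> - t \<in> \<Theta>"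
begin

lemma space_\<mu>: "space \<mu> = \<Omega>"
  using sets_eq_imp_space_eq[OF sets_\<mu>] by (simp add: space_restrict_space)

lemma measurable_\<mu>: "f \<in> borel_measurable borel \<Longrightarrow> f \<in> borel_measurable \<mu>"
  using measurable_restrict_space1[of f borel borel \<Omega>] measurable_cong_sets[OF sets_\<mu> refl] by blast

lemma harmonic_measurable: "harmonic t \<in> borel_measurable \<mu>"
  unfolding harmonic_def
  by (intro measurable_\<mu> borel_measurable_continuous_onI continuous_intros)

lemma harmonic_square_integrable: "harmonic t \<in> square_integrable \<mu>"
  by (rule square_integrable_bounded[OF finite_\<mu> harmonic_measurable, of _ 1]) simp

lemma cis_measurable: "(\<lambda>u. cis (c * u)) \<in> borel_measurable \<mu>"
  by (intro measurable_\<mu> borel_measurable_continuous_onI continuous_intros)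

text \<open>
  Stone-Weierstrass on the circle approximates uniformly, which suffices because \<open>\<mu>\<close> is finite.
\<close>
lemma continuous_on_circle_in_closed_span:
  fixes h :: "complex \<Rightarrow> real"
  assumes c: "c \<in> \<Theta>" and h: "continuous_on UNIV h"
  shows "(\<lambda>u. complex_of_real (h (cis (c * u)))) \<in> closed_span \<mu> \<Theta> harmonic"
proof -
  interpret finite_measure \<mu> by (rule finite_\<mu>)
  have [measurable]: "h \<in> borel_measurable borel"
    by (rule borel_measurable_continuous_onI[OF h])
  note [measurable] = cis_measurable
  have "compact (h ` sphere 0 1)"
    by (intro compact_continuous_image continuous_on_subset[OF h]) auto
  then obtain K where "\<forall>y\<in>h ` sphere 0 1. norm y \<le> K"
    using compact_imp_bounded bounded_iff by metis
  then have K: "\<bar>h (cis x)\<bar> \<le> K" for x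
    by simp
  show ?thesis
    unfolding closed_span_iff
  proof (intro conjI allI impI)
    show "(\<lambda>u. complex_of_real (h (cis (c * u)))) \<in> square_integrable \<mu>"
      by (rule square_integrable_bounded[OF finite_\<mu>, of _ K]) (simp_all add: K)
    fix e :: real assume "e > 0"
    \<comment> \<open>A uniform error \<open>e / m\<close> has \<open>L\<^sub>2\<close> norm below \<open>e\<close>; adding 1 covers the zero measure.\<close>
    define m where "m = sqrt (measure \<mu> (space \<mu>)) + 1"
    have "m > 0" by (auto simp: m_def intro: add_nonneg_pos)
    with \<open>e > 0\<close> have "e / m > 0" by simp
    then obtain p where p: "real_polynomial_function p" "\<And>z. z \<in> sphere 0 1 \<Longrightarrow> \<bar>h z - p z\<bar> < e / m"
      using Stone_Weierstrass_real_polynomial_function[of "sphere 0 1" h "e / m"]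
        continuous_on_subset[OF h] by (metis compact_sphere subset_UNIV)
    let ?g = "\<lambda>u. complex_of_real (p (cis (c * u)))"
    have g: "?g \<in> lin_span \<Theta> harmonic"
      using c p(1) by (intro polynomial_on_circle_in_harmonic_span zero_in add_in minus_in)
    have "l2norm \<mu> (\<lambda>u. complex_of_real (h (cis (c * u))) - ?g u) \<le> l2norm \<mu> (\<lambda>u. complex_of_real (e / m) * 1)"
    proof (rule l2norm_mono)
      have "?g \<in> borel_measurable \<mu>"
        by (intro square_integrable_measurable lin_span_square_integrable[OF harmonic_square_integrable g])
      then show "(\<lambda>u. complex_of_real (h (cis (c * u))) - ?g u) \<in> borel_measurable \<mu>"
        by measurable
      show "(\<lambda>u. complex_of_real (e / m) * 1) \<in> square_integrable \<mu>"
        by (rule square_integrable_bounded[OF finite_\<mu>, of _ "e / m"]) (use \<open>e > 0\<close> \<open>m > 0\<close> in \<open>auto simp: norm_divide\<close>)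
      show "cmod (complex_of_real (h (cis (c * u))) - ?g u) \<le> cmod (complex_of_real (e / m) * 1)" for u
        using p(2)[of "cis (c * u)"] \<open>e > 0\<close> \<open>m > 0\<close>
        by (simp flip: of_real_diff of_real_divide)
    qed
    also have "\<dots> = (e / m) * sqrt (measure \<mu> (space \<mu>))"
      using \<open>e > 0\<close> \<open>m > 0\<close> unfolding l2norm_cmult by (simp add: l2norm_def norm_divide)
    also have "\<dots> < (e / m) * m"
      using \<open>e > 0\<close> \<open>m > 0\<close> by (intro mult_strict_left_mono) (auto simp: m_def)
    finally show "\<exists>g\<in>lin_span \<Theta> harmonic. l2norm \<mu> (\<lambda>u. complex_of_real (h (cis (c * u))) - g u) < e"
      using g \<open>m > 0\<close> by (intro bexI[of _ ?g]) auto
  qed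
qed

text \<open>
  The continuous functions \<open>max 0 (1 - n dist(z, A))\<close> decrease to the indicator of a closed set \<open>A\<close>.
  The empty set is treated apart because the distance to it is 0 by convention.
\<close>
lemma closed_on_circle_in_closed_span:
  assumes c: "c \<in> \<Theta>" and A: "closed A"
  shows "(\<lambda>u. indicator A (cis (c * u))) \<in> closed_span \<mu> \<Theta> harmonic"
proof (cases "A = {}")
  case True
  then show ?thesis
    using closed_span_sum[OF harmonic_square_integrable, of "{}"] by simp
next
  case False
  define h where "h n z = max 0 (1 - real n * infdist z A)" for n z
  show ?thesis
  proof (rule closed_span_bounded_limit[OF finite_\<mu> harmonic_square_integrable])
    show "(\<lambda>u. complex_of_real (h n (cis (c * u)))) \<in> closed_span \<mu> \<Theta> harmonic" for n
      unfolding h_def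
      by (intro continuous_on_circle_in_closed_span c continuous_intros)
    show "cmod (complex_of_real (h n (cis (c * u)))) \<le> 1" for n u
      by (auto simp: h_def infdist_nonneg)
    show "(\<lambda>n. complex_of_real (h n (cis (c * u)))) \<longlonglongrightarrow> indicator A (cis (c * u))" for u
    proof (cases "cis (c * u) \<in> A")
      case True
      then have "h n (cis (c * u)) = 1" for n by (simp add: h_def)
      with True show ?thesis by simp
    next
      case notin: False
      then have pos: "infdist (cis (c * u)) A > 0"
        using A \<open>A \<noteq> {}\<close> by (simp add: infdist_pos_not_in_closed)
      obtain N where N: "1 < real N * infdist (cis (c * u)) A"
        using reals_Archimedean3[OF pos] by blast
      have "h n (cis (c * u)) = 0" if "n \<ge> N" for n
      proof -
        have "real N * infdist (cis (c * u)) A \<le> real n * infdist (cis (c * u)) A"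
          using that pos by (intro mult_right_mono) auto
        with N show ?thesis by (simp add: h_def)
      qed
      then have "\<forall>\<^sub>F n in sequentially. complex_of_real (h n (cis (c * u))) = 0"
        by (auto simp: eventually_sequentially)
      from tendsto_eventually[OF this] notin show ?thesis by simp
    qed
  qed
qed

text \<open>
  Closed sets are stable under intersection and generate the Borel sets, and the closed span is closed
  under complements and countable disjoint unions of indicators.
\<close>
lemma borel_on_circle_in_closed_span:
  assumes c: "c \<in> \<Theta>" and A: "A \<in> sets borel"
  shows "(\<lambda>u. indicator A (cis (c * u))) \<in> closed_span \<mu> \<Theta> harmonic"
proof -
  have "Int_stable (Collect (closed :: complex set \<Rightarrow> bool))"
    by (auto simp: Int_stable_def)
  moreover have "Collect closed \<subseteq> Pow (UNIV :: complex set)"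
    by simp
  moreover have "A \<in> sigma_sets UNIV (Collect closed)"
    using A by (simp add: borel_eq_closed)
  ultimately show ?thesis
  proof (induction A rule: sigma_sets_induct_disjoint)
    case (basic A)
    with c show ?case by (simp add: closed_on_circle_in_closed_span)
  next
    case empty
    then show ?case using closed_on_circle_in_closed_span[OF c closed_empty] by simp
  next
    case (compl A)
    have "(\<lambda>u. 1 * indicator UNIV (cis (c * u)) + (- 1) * indicator A (cis (c * u)))
            \<in> closed_span \<mu> \<Theta> harmonic"
      by (intro closed_span_lincomb harmonic_square_integrable compl.IH
          closed_on_circle_in_closed_span c closed_UNIV)
    then show ?case by (simp add: indicator_diff)
  next
    case (union A)
    show ?case
    proof (rule closed_span_bounded_limit[OF finite_\<mu> harmonic_square_integrable])
      have "indicator (\<Union>i<n. A i) z = (\<Sum>i<n. 1 * indicator (A i) z :: complex)" for n z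
        using union.hyps(1)
        by (simp add: indicator_UN_disjoint disjoint_family_on_mono[of "{..<n}" UNIV])
      with closed_span_sum[OF harmonic_square_integrable union.IH, where J = "{..<_}" and c = "\<lambda>_. 1"]
      show "(\<lambda>u. indicator (\<Union>i<n. A i) (cis (c * u))) \<in> closed_span \<mu> \<Theta> harmonic" for n
        by simp
      show "cmod (indicator (\<Union>i<n. A i) (cis (c * u))) \<le> 1" for n u
        by (simp add: indicator_def)
      show "(\<lambda>n. indicator (\<Union>i<n. A i) (cis (c * u))) \<longlonglongrightarrow> (indicator (\<Union>i. A i) (cis (c * u)) :: complex)" for u
        by (rule LIMSEQ_indicator_UN)
    qed
  qed
qed

text \<open>
  The map \<open>u \<mapsto> e\<^sup>i\<^sup>c\<^sup>u\<close> sends frequencies to the circle, and \<open>a n\<close> is a measurable section of the map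
  with \<open>c = c n\<close>, valid at each frequency for large \<open>n\<close>. Then the indicator of a set \<open>S\<close> of
  frequencies is the pointwise limit of the indicators of the sets \<open>(a n)\<^sup>-\<^sup>1(S)\<close> evaluated along the
  circle, so that all indicators, all simple functions and finally all of \<open>L\<^sub>2(\<mu>)\<close> are reached.
\<close>
lemma harmonics_dense:
  assumes c: "\<And>n::nat. c n \<in> \<Theta>" and a: "\<And>n. a n \<in> borel_measurable borel"
    and inverse: "\<And>u. u \<in> \<Omega> \<Longrightarrow> \<forall>\<^sub>F n in sequentially. a n (cis (c n * u)) = u"
  shows "closed_span \<mu> \<Theta> harmonic = square_integrable \<mu>"
proof
  show "closed_span \<mu> \<Theta> harmonic \<subseteq> square_integrable \<mu>"
    by (auto simp: closed_span_iff)
  have ind: "indicator A \<in> closed_span \<mu> \<Theta> harmonic" if A: "A \<in> sets \<mu>" for A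
  proof -
    obtain S where S: "S \<in> sets borel" "A = \<Omega> \<inter> S"
      using A by (auto simp: sets_\<mu> sets_restrict_space)
    show ?thesis
    proof (rule closed_span_bounded_limit[OF finite_\<mu> harmonic_square_integrable])
      have "a n -` S \<in> sets borel" for n
        using measurable_sets[OF a S(1)] by simp
      then show "(\<lambda>u. indicator (a n -` S) (cis (c n * u))) \<in> closed_span \<mu> \<Theta> harmonic" for n
        by (intro borel_on_circle_in_closed_span c)
      show "cmod (indicator (a n -` S) (cis (c n * u))) \<le> 1" for n u
        by (simp add: indicator_def)
      show "(\<lambda>n. indicator (a n -` S) (cis (c n * u))) \<longlonglongrightarrow> (indicator A u :: complex)"
        if "u \<in> space \<mu>" for u
      proof (rule tendsto_eventually)
        have "u \<in> \<Omega>" using that by (simp add: space_\<mu>)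
        from inverse[OF this]
        show "\<forall>\<^sub>F n in sequentially. indicator (a n -` S) (cis (c n * u)) = (indicator A u :: complex)"
          by eventually_elim (use \<open>u \<in> \<Omega>\<close> S(2) in \<open>auto simp: indicator_def\<close>)
      qed
    qed
  qed
  have simple: "s \<in> closed_span \<mu> \<Theta> harmonic" if s: "simple_function \<mu> s" for s
  proof -
    have "(\<lambda>u. \<Sum>y\<in>s ` space \<mu>. y * indicator (s -` {y} \<inter> space \<mu>) u) \<in> closed_span \<mu> \<Theta> harmonic"
      by (intro closed_span_sum harmonic_square_integrable ind simple_functionD[OF s])
    moreover have "(\<Sum>y\<in>s ` space \<mu>. y * indicator (s -` {y} \<inter> space \<mu>) u) = s u" if "u \<in> space \<mu>" for u
    proof -
      have "(\<Sum>y\<in>s ` space \<mu>. y * indicator (s -` {y} \<inter> space \<mu>) u)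
              = (\<Sum>y\<in>s ` space \<mu>. if y = s u then y else 0)"
        using that by (intro sum.cong) (auto simp: indicator_def)
      then show ?thesis
        using that simple_functionD(1)[OF s] by simp
    qed
    ultimately show ?thesis
      by (rule closed_span_cong)
  qed
  show "square_integrable \<mu> \<subseteq> closed_span \<mu> \<Theta> harmonic"
  proof
    fix f assume f: "f \<in> square_integrable \<mu>"
    then obtain s where s: "\<And>n. simple_function \<mu> (s n)"
      and lim: "(\<lambda>n. l2norm \<mu> (\<lambda>u. f u - s n u)) \<longlonglongrightarrow> 0"
      using square_integrable_simple_approx by blast
    show "f \<in> closed_span \<mu> \<Theta> harmonic"
    proof (rule closed_span_limit[OF harmonic_square_integrable f])
      fix e :: real assume "e > 0"
      from eventually_happens'[OF sequentially_bot order_tendstoD(2)[OF lim this]] simple[OF s]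
      show "\<exists>g\<in>closed_span \<mu> \<Theta> harmonic. l2norm \<mu> (\<lambda>u. f u - g u) < e" by blast
    qed
  qed
qed

end

lemma harmonics_dense_Ints:
  assumes "finite_measure \<mu>" "sets \<mu> = sets (restrict_space borel {-pi..<pi})"
  shows "closed_span \<mu> \<int> harmonic = square_integrable \<mu>"
proof -
  interpret harmonic_L2 \<mu> "{-pi..<pi}" \<int>
    by (rule harmonic_L2.intro) (fact assms | simp)+
  \<comment> \<open>The principal argument takes values in \<open>(-pi, pi]\<close>; the frequency interval contains the other endpoint.\<close>
  define a where "a z = (if Im (Ln z) = pi then - pi else Im (Ln z))" for z
  have [measurable]: "Im \<in> borel_measurable borel"
    by (intro borel_measurable_continuous_onI continuous_intros)
  show ?thesis
  proof (rule harmonics_dense[where c = "\<lambda>_. 1" and a = "\<lambda>_. a"])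
    show "a \<in> borel_measurable borel"
      unfolding a_def by measurable
    fix u assume u: "u \<in> {-pi..<pi}"
    have "a (cis u) = u"
    proof (cases "u = - pi")
      case True
      then have "cis u = - 1" by (simp add: complex_eq_iff)
      with True show ?thesis by (simp add: a_def)
    next
      case False
      with u show ?thesis
        using Arg_cis[of u] by (simp add: a_def Arg_eq_Im_Ln)
    qed
    then show "\<forall>\<^sub>F n in sequentially. a (cis (1 * u)) = u" by simp
  qed simp
qed

lemma harmonics_dense_UNIV:
  assumes "finite_measure \<mu>" "sets \<mu> = sets (restrict_space borel UNIV)"
  shows "closed_span \<mu> UNIV harmonic = square_integrable \<mu>"
proof -
  interpret harmonic_L2 \<mu> UNIV UNIV
    by (rule harmonic_L2.intro) (fact assms | simp)+
  have [measurable]: "Im \<in> borel_measurable borel"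
    by (intro borel_measurable_continuous_onI continuous_intros)
  show ?thesis
  proof (rule harmonics_dense[where c = "\<lambda>n. 1 / Suc n" and a = "\<lambda>n z. Im (Ln z) * Suc n"])
    show "(\<lambda>z. Im (Ln z) * Suc n) \<in> borel_measurable borel" for n
      by measurable
    fix u :: real
    \<comment> \<open>Once \<open>\<bar>u\<bar> < n pi\<close>, the principal argument of \<open>e\<^sup>i\<^sup>u\<^sup>/\<^sup>n\<close> is \<open>u / n\<close>.\<close>
    obtain N :: nat where N: "\<bar>u\<bar> < real N * pi"
      using reals_Archimedean3[OF pi_gt_zero] by blast
    have "Im (Ln (cis (1 / Suc n * u))) * Suc n = u" if "n \<ge> N" for n
    proof -
      have "real N * pi \<le> real (Suc n) * pi"
        using that by (intro mult_right_mono) auto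
      with N have "\<bar>u\<bar> < real (Suc n) * pi" by linarith
      then have "\<bar>u\<bar> / Suc n < pi"
        by (simp add: pos_divide_less_eq mult.commute)
      then have "\<bar>u / Suc n\<bar> < pi"
        by (simp del: of_nat_Suc)
      then have "Arg (cis (u / Suc n)) = u / Suc n"
        by (intro Arg_cis) (auto simp: abs_less_iff simp del: of_nat_Suc abs_divide)
      then have "Im (Ln (cis (u / Suc n))) = u / Suc n"
        by (simp add: Arg_eq_Im_Ln del: of_nat_Suc)
      then show ?thesis by (simp del: of_nat_Suc)
    qed
    then show "\<forall>\<^sub>F n in sequentially. Im (Ln (cis (1 / Suc n * u))) * Suc n = u"
      by (auto simp: eventually_sequentially)
  qed simp
qed

section \<open>Spectral representation of the closed span\<close>

context orthogonal_measure
begin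

lemma has_stoch_integral_sum:
  assumes "finite F" "\<And>t. t \<in> F \<Longrightarrow> has_stoch_integral M \<mu> W (E t) (B t)"
  shows "has_stoch_integral M \<mu> W (\<lambda>u. \<Sum>t\<in>F. c t * E t u) (\<lambda>x. \<Sum>t\<in>F. c t * B t x)"
  using assms
proof (induction F)
  case empty
  then show ?case
    using has_stoch_integral_lincomb[OF has_stoch_integral_simple has_stoch_integral_simple,
        of "\<lambda>_. 0" "\<lambda>_. 0" 0 0] by simp
next
  case (insert t F)
  then have "has_stoch_integral M \<mu> W (\<lambda>u. c t * E t u + 1 * (\<Sum>t\<in>F. c t * E t u))
      (\<lambda>x. c t * B t x + 1 * (\<Sum>t\<in>F. c t * B t x))"
    by (intro has_stoch_integral_lincomb) auto
  with insert show ?case by simp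
qed

text \<open>
  Isometry transports an approximation of \<open>\<phi>\<close> by combinations of the \<open>E t\<close> to one of its integral by the
  same combinations of the \<open>B t\<close>.
\<close>
lemma stoch_integral_in_closed_span:
  assumes EB: "\<And>t. t \<in> \<Theta> \<Longrightarrow> has_stoch_integral M \<mu> W (E t) (B t)"
    and \<xi>: "has_stoch_integral M \<mu> W \<phi> \<xi>" and \<phi>: "\<phi> \<in> closed_span \<mu> \<Theta> E"
  shows "\<xi> \<in> closed_span M \<Theta> B"
  unfolding closed_span_iff
proof (intro conjI allI impI)
  show "\<xi> \<in> square_integrable M"
    using \<xi> by (rule has_stoch_integral_square_integrable)
  fix e :: real assume "e > 0"
  with \<phi> obtain F c where F: "finite F" "F \<subseteq> \<Theta>"
    and le: "l2norm \<mu> (\<lambda>u. \<phi> u - (\<Sum>t\<in>F. c t * E t u)) < e"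
    unfolding closed_span_iff lin_span_def by blast
  have "has_stoch_integral M \<mu> W (\<lambda>u. \<Sum>t\<in>F. c t * E t u) (\<lambda>x. \<Sum>t\<in>F. c t * B t x)"
    using F EB by (intro has_stoch_integral_sum) auto
  with le have "l2norm M (\<lambda>x. \<xi> x - (\<Sum>t\<in>F. c t * B t x)) < e"
    by (simp add: has_stoch_integral_dist[OF \<xi>])
  with F show "\<exists>g\<in>lin_span \<Theta> B. l2norm M (\<lambda>x. \<xi> x - g x) < e"
    by (intro bexI[of _ "\<lambda>x. \<Sum>t\<in>F. c t * B t x"]) (auto simp: lin_span_def)
qed

text \<open>
  The converse transport: approximating combinations of the \<open>B t\<close> are Cauchy, hence by isometry so are
  the combinations of the \<open>E t\<close>, and completeness of \<open>L\<^sub>2(\<mu>)\<close> provides the representation.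
\<close>
lemma closed_span_has_spectral_rep:
  assumes EB: "\<And>t. t \<in> \<Theta> \<Longrightarrow> has_stoch_integral M \<mu> W (E t) (B t)"
    and Y: "Y \<in> closed_span M \<Theta> B"
  shows "has_stoch_integral M \<mu> W (spectral_rep M \<mu> W Y) Y"
proof -
  have Ysq: "Y \<in> square_integrable M"
    using Y by (simp add: closed_span_iff)
  \<comment> \<open>Each \<open>p n\<close> pairs a linear combination of the \<open>E t\<close> with its stochastic integral.\<close>
  have "\<exists>p. \<forall>n. has_stoch_integral M \<mu> W (fst (p n)) (snd (p n)) \<and>
      l2norm M (\<lambda>x. Y x - snd (p n) x) < 1 / Suc n"
  proof (rule choice, rule allI)
    fix n :: nat
    have "(0::real) < 1 / Suc n" by simp
    with Y obtain F c where F: "finite F" "F \<subseteq> \<Theta>"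
      and le: "l2norm M (\<lambda>x. Y x - (\<Sum>t\<in>F. c t * B t x)) < 1 / Suc n"
      unfolding closed_span_iff lin_span_def by blast
    have "has_stoch_integral M \<mu> W (\<lambda>u. \<Sum>t\<in>F. c t * E t u) (\<lambda>x. \<Sum>t\<in>F. c t * B t x)"
      using F EB by (intro has_stoch_integral_sum) auto
    with le show "\<exists>p. has_stoch_integral M \<mu> W (fst p) (snd p) \<and>
        l2norm M (\<lambda>x. Y x - snd p x) < 1 / Suc n"
      by (intro exI[of _ "(\<lambda>u. \<Sum>t\<in>F. c t * E t u, \<lambda>x. \<Sum>t\<in>F. c t * B t x)"]) simp
  qed
  then obtain p where p: "\<And>n. has_stoch_integral M \<mu> W (fst (p n)) (snd (p n))"
    and le: "\<And>n. l2norm M (\<lambda>x. Y x - snd (p n) x) < 1 / Suc n"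
    by blast
  note sq = has_stoch_integral_square_integrable[OF p]
  have lim: "(\<lambda>n. l2norm M (\<lambda>x. Y x - snd (p n) x)) \<longlonglongrightarrow> 0"
    by (rule tendsto_sandwich[OF _ _ tendsto_const LIMSEQ_Suc[OF lim_1_over_n]])
       (use le in \<open>auto intro!: eventuallyI less_imp_le\<close>)
  obtain \<phi> where \<phi>: "\<phi> \<in> square_integrable \<mu>" "(\<lambda>n. l2norm \<mu> (\<lambda>u. \<phi> u - fst (p n) u)) \<longlonglongrightarrow> 0"
  proof (rule l2_complete[OF finite_\<mu>, of "\<lambda>n. fst (p n)"])
    fix e :: real assume "e > 0"
    from l2_Cauchy_of_convergent[OF Ysq sq(2) lim this]
    show "\<exists>K. \<forall>m\<ge>K. \<forall>n\<ge>K. l2norm \<mu> (\<lambda>u. fst (p m) u - fst (p n) u) < e"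
      by (simp add: has_stoch_integral_dist[OF p p])
  qed (use sq in auto)
  have "has_stoch_integral M \<mu> W \<phi> Y"
  proof (rule has_stoch_integral_limit[OF \<phi>(1) Ysq])
    fix e :: real assume "e > 0"
    from eventually_happens'[OF sequentially_bot
        eventually_conj[OF order_tendstoD(2)[OF \<phi>(2) this] order_tendstoD(2)[OF lim this]]]
    show "\<exists>\<psi> \<eta>. has_stoch_integral M \<mu> W \<psi> \<eta> \<and>
        l2norm \<mu> (\<lambda>u. \<phi> u - \<psi> u) < e \<and> l2norm M (\<lambda>x. Y x - \<eta> x) < e"
      using p by blast
  qed
  then show ?thesis
    unfolding spectral_rep_def by (rule someI[of "\<lambda>\<phi>. has_stoch_integral M \<mu> W \<phi> Y"])
qed

lemma has_stoch_integral_stoch_integral: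
  assumes "\<phi> \<in> square_integrable \<mu>"
  shows "has_stoch_integral M \<mu> W \<phi> (stoch_integral M \<mu> W \<phi>)"
  unfolding stoch_integral_def using has_stoch_integral_exists[OF assms] by (rule someI_ex)

end

section \<open>Optimal filtering\<close>

text \<open>
  Completing the square: both sides equal \<open>(1 + a) \<bar>z\<bar>\<^sup>2 - 2 Re z + 1\<close>.
\<close>
lemma power2_penalty_eq:
  fixes z w :: complex
  defines "a \<equiv> (cmod w)\<^sup>2"
  shows "(cmod (z - 1))\<^sup>2 + (cmod (w * z))\<^sup>2
           = (1 + a) * (cmod (z - complex_of_real (1 / (1 + a))))\<^sup>2 + a / (1 + a)"
proof -
  define p where "p = 1 / (1 + a)"
  have p: "(1 + a) * p = 1" "a / (1 + a) = 1 - p"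
    using add_pos_nonneg[of 1 a] by (simp_all add: p_def a_def field_simps)
  have p2: "(1 + a) * p\<^sup>2 = p"
    using p(1) by (simp add: power2_eq_square flip: mult.assoc)
  have sq: "(cmod (z - complex_of_real q))\<^sup>2 = (cmod z)\<^sup>2 - 2 * q * Re z + q\<^sup>2" for q
    unfolding cmod_power2 by (simp add: power2_eq_square algebra_simps)
  have "(cmod (z - 1))\<^sup>2 + (cmod (w * z))\<^sup>2 = (1 + a) * (cmod z)\<^sup>2 - 2 * Re z + 1"
    using sq[of 1] by (simp add: norm_mult power_mult_distrib a_def algebra_simps)
  also have "\<dots> = (1 + a) * (cmod z)\<^sup>2 - 2 * ((1 + a) * p) * Re z + (1 + a) * p\<^sup>2 + (1 - p)"
    by (simp add: p p2)
  also have "\<dots> = (1 + a) * (cmod (z - complex_of_real p))\<^sup>2 + (1 - p)"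
    unfolding sq by (simp add: algebra_simps)
  finally show ?thesis
    by (simp add: p(2) p_def)
qed

locale filtered_process = orthogonal_measure M \<mu> W
  for M :: "'a measure" and \<mu> :: "real measure" and W :: "real set \<Rightarrow> 'a \<Rightarrow> complex" +
  fixes \<Theta> :: "real set" and B :: "real \<Rightarrow> 'a \<Rightarrow> complex" and ell :: "real \<Rightarrow> complex"
  assumes zero_in: "0 \<in> \<Theta>"
    and B_rep: "\<And>t. t \<in> \<Theta> \<Longrightarrow> has_stoch_integral M \<mu> W (harmonic t) (B t)"
    and dense: "closed_span \<mu> \<Theta> harmonic = square_integrable \<mu>"
    and ell_measurable: "ell \<in> borel_measurable \<mu>"
begin

abbreviation "gain u \<equiv> (cmod (ell u))\<^sup>2"
abbreviation "optimum u \<equiv> complex_of_real (1 / (1 + gain u))"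
abbreviation "objective Y \<equiv> (\<integral>x. (cmod (Y x - B 0 x))\<^sup>2 \<partial>M)
    + (\<integral>x. (cmod (linear_filter M \<mu> W ell Y x))\<^sup>2 \<partial>M)"

sublocale mu: finite_measure \<mu>
  by (rule finite_\<mu>)

lemmas [measurable] = ell_measurable

lemma gain_bounds: "0 \<le> gain u / (1 + gain u)" "gain u / (1 + gain u) \<le> 1"
    "0 \<le> 1 / (1 + gain u)" "1 / (1 + gain u) \<le> 1"
  using add_pos_nonneg[of 1 "gain u"] by (simp_all add: divide_le_eq_1)

lemma integrable_gain: "integrable \<mu> (\<lambda>u. gain u / (1 + gain u))"
  by (rule mu.integrable_const_bound[where B = 1]) (use gain_bounds in auto)

lemma integrable_optimum: "integrable \<mu> (\<lambda>u. 1 / (1 + gain u))"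
  by (rule mu.integrable_const_bound[where B = 1]) (use gain_bounds in auto)

lemma optimum_square_integrable: "optimum \<in> square_integrable \<mu>"
proof (rule square_integrable_bounded[OF finite_\<mu>, of _ 1])
  show "cmod (optimum u) \<le> 1" for u
    unfolding norm_of_real using gain_bounds[of u] by linarith
qed measurable

lemma filtered_optimum_bounded: "cmod (ell u * optimum u) \<le> 1"
proof -
  have "cmod (ell u) \<le> 1 + gain u"
  proof -
    have "2 * cmod (ell u) \<le> gain u + 1"
      using sum_squares_bound[of "cmod (ell u)" 1] by simp
    with norm_ge_zero[of "ell u"] show ?thesis by linarith
  qed
  then have "cmod (ell u) / (1 + gain u) \<le> 1"
    using add_pos_nonneg[of 1 "gain u"] by (simp add: divide_le_eq_1)
  then show ?thesis
    unfolding norm_mult norm_of_real using gain_bounds(3)[of u] by simp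
qed

text \<open>
  The objective splits into a weighted squared distance of the spectral representation from the optimal
  one and a constant. Integrability of the first part is recorded since a vanishing integral has to
  give a vanishing integrand.
\<close>
lemma objective_eq:
  assumes Y: "Y \<in> filter_domain M \<Theta> B \<mu> W ell"
  defines "\<phi> \<equiv> spectral_rep M \<mu> W Y"
  shows "integrable \<mu> (\<lambda>u. (1 + gain u) * (cmod (\<phi> u - optimum u))\<^sup>2)"
    and "objective Y = (\<integral>u. (1 + gain u) * (cmod (\<phi> u - optimum u))\<^sup>2 \<partial>\<mu>)
           + (\<integral>u. gain u / (1 + gain u) \<partial>\<mu>)"
proof -
  have Y': "Y \<in> closed_span M \<Theta> B" and i\<phi>: "integrable \<mu> (\<lambda>u. (cmod (ell u * \<phi> u))\<^sup>2)"
    using Y by (simp_all add: filter_domain_def \<phi>_def)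
  have h: "has_stoch_integral M \<mu> W \<phi> Y"
    unfolding \<phi>_def by (rule closed_span_has_spectral_rep[OF B_rep Y'])
  have h0: "has_stoch_integral M \<mu> W (\<lambda>u. 1) (B 0)"
    using B_rep[OF zero_in] by (simp add: harmonic_zero)
  have hd: "has_stoch_integral M \<mu> W (\<lambda>u. \<phi> u - 1) (\<lambda>x. Y x - B 0 x)"
    by (rule has_stoch_integral_diff[OF h h0])
  have [measurable]: "\<phi> \<in> borel_measurable \<mu>"
    using has_stoch_integral_square_integrable(1)[OF h] by (rule square_integrable_measurable)
  have "(\<lambda>u. ell u * \<phi> u) \<in> square_integrable \<mu>"
    using i\<phi> by (simp add: square_integrable_def)
  then have hL: "has_stoch_integral M \<mu> W (\<lambda>u. ell u * \<phi> u) (linear_filter M \<mu> W ell Y)"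
    unfolding linear_filter_def \<phi>_def by (rule has_stoch_integral_stoch_integral)
  have i1: "integrable \<mu> (\<lambda>u. (cmod (\<phi> u - 1))\<^sup>2)"
    using has_stoch_integral_square_integrable(1)[OF hd] by (simp add: square_integrable_def)
  have pt: "(1 + gain u) * (cmod (\<phi> u - optimum u))\<^sup>2
      = (cmod (\<phi> u - 1))\<^sup>2 + (cmod (ell u * \<phi> u))\<^sup>2 - gain u / (1 + gain u)" for u
    using power2_penalty_eq[of "\<phi> u" "ell u"] by linarith
  show "integrable \<mu> (\<lambda>u. (1 + gain u) * (cmod (\<phi> u - optimum u))\<^sup>2)"
    unfolding pt using i1 i\<phi> integrable_gain by (intro Bochner_Integration.integrable_diff Bochner_Integration.integrable_add)
  have "objective Y = (\<integral>u. (cmod (\<phi> u - 1))\<^sup>2 \<partial>\<mu>) + (\<integral>u. (cmod (ell u * \<phi> u))\<^sup>2 \<partial>\<mu>)"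
    unfolding l2norm_power2[symmetric]
      has_stoch_integral_isometry[OF hd] has_stoch_integral_isometry[OF hL] ..
  then show "objective Y = (\<integral>u. (1 + gain u) * (cmod (\<phi> u - optimum u))\<^sup>2 \<partial>\<mu>)
      + (\<integral>u. gain u / (1 + gain u) \<partial>\<mu>)"
    unfolding pt using i1 i\<phi> integrable_gain
    by (simp only: Bochner_Integration.integral_diff Bochner_Integration.integral_add Bochner_Integration.integrable_add)
qed

definition "best_estimate = stoch_integral M \<mu> W optimum"

lemma best_estimate_rep: "has_stoch_integral M \<mu> W optimum best_estimate"
  unfolding best_estimate_def by (rule has_stoch_integral_stoch_integral[OF optimum_square_integrable])

lemma best_estimate_in_span: "best_estimate \<in> closed_span M \<Theta> B"
  by (rule stoch_integral_in_closed_span[OF B_rep best_estimate_rep]) (simp_all only: dense optimum_square_integrable)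

lemma spectral_rep_best_estimate:
  "has_stoch_integral M \<mu> W (spectral_rep M \<mu> W best_estimate) best_estimate" "AE u in \<mu>. spectral_rep M \<mu> W best_estimate u = optimum u"
proof -
  show 1: "has_stoch_integral M \<mu> W (spectral_rep M \<mu> W best_estimate) best_estimate"
    by (rule closed_span_has_spectral_rep[OF B_rep best_estimate_in_span])
  then show "AE u in \<mu>. spectral_rep M \<mu> W best_estimate u = optimum u"
    using has_stoch_integral_AE_iff[OF 1 best_estimate_rep] by simp
qed

lemma best_estimate_in_domain: "best_estimate \<in> filter_domain M \<Theta> B \<mu> W ell"
proof -
  have [measurable]: "spectral_rep M \<mu> W best_estimate \<in> borel_measurable \<mu>"
    using has_stoch_integral_square_integrable(1)[OF spectral_rep_best_estimate(1)]
    by (rule square_integrable_measurable)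
  have "integrable \<mu> (\<lambda>u. (cmod (ell u * spectral_rep M \<mu> W best_estimate u))\<^sup>2)"
  proof (rule mu.integrable_const_bound[where B = 1])
    show "AE u in \<mu>. norm ((cmod (ell u * spectral_rep M \<mu> W best_estimate u))\<^sup>2) \<le> 1"
      using spectral_rep_best_estimate(2)
    proof eventually_elim
      fix u assume eq: "spectral_rep M \<mu> W best_estimate u = optimum u"
      show "norm ((cmod (ell u * spectral_rep M \<mu> W best_estimate u))\<^sup>2) \<le> 1"
        unfolding eq real_norm_def abs_power2
        by (intro power_le_one norm_ge_zero filtered_optimum_bounded)
    qed
  qed measurable
  then show ?thesis
    by (simp add: filter_domain_def best_estimate_in_span)
qed

lemma objective_best_estimate: "objective best_estimate = (\<integral>u. gain u / (1 + gain u) \<partial>\<mu>)"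
proof -
  have "AE u in \<mu>. (1 + gain u) * (cmod (spectral_rep M \<mu> W best_estimate u - optimum u))\<^sup>2 = 0"
    using spectral_rep_best_estimate(2) by eventually_elim simp
  then have "(\<integral>u. (1 + gain u) * (cmod (spectral_rep M \<mu> W best_estimate u - optimum u))\<^sup>2 \<partial>\<mu>) = 0"
    by (rule integral_eq_zero_AE)
  then show ?thesis
    using objective_eq(2)[OF best_estimate_in_domain] by linarith
qed

lemma objective_best_estimate_le:
  assumes "Y \<in> filter_domain M \<Theta> B \<mu> W ell"
  shows "objective best_estimate \<le> objective Y"
proof -
  have "0 \<le> (\<integral>u. (1 + gain u) * (cmod (spectral_rep M \<mu> W Y u - optimum u))\<^sup>2 \<partial>\<mu>)"
    by (rule integral_nonneg_AE) simp
  then show ?thesis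
    using objective_best_estimate objective_eq(2)[OF assms] by linarith
qed

lemma minimizer_unique:
  assumes Y: "Y \<in> filter_domain M \<Theta> B \<mu> W ell" and le: "objective Y \<le> objective best_estimate"
  shows "AE x in M. Y x = best_estimate x"
proof -
  let ?d = "\<lambda>u. (1 + gain u) * (cmod (spectral_rep M \<mu> W Y u - optimum u))\<^sup>2"
  have "0 \<le> integral\<^sup>L \<mu> ?d"
    by (rule integral_nonneg_AE) simp
  then have "integral\<^sup>L \<mu> ?d = 0"
    using le objective_best_estimate objective_eq(2)[OF Y] by linarith
  then have "AE u in \<mu>. ?d u = 0"
    using integral_nonneg_eq_0_iff_AE[OF objective_eq(1)[OF Y]] by simp
  then have "AE u in \<mu>. spectral_rep M \<mu> W Y u = optimum u"
  proof eventually_elim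
    fix u assume "?d u = 0"
    moreover have "1 + gain u \<noteq> 0"
      using add_pos_nonneg[of 1 "gain u"] by simp
    ultimately show "spectral_rep M \<mu> W Y u = optimum u" by simp
  qed
  moreover have "Y \<in> closed_span M \<Theta> B"
    using Y by (simp add: filter_domain_def)
  note closed_span_has_spectral_rep[OF B_rep this]
  ultimately show ?thesis
    using has_stoch_integral_AE_iff[OF _ best_estimate_rep] by blast
qed

text \<open>
  The harmonic of time 0 is constantly 1, so the variance of \<open>B(0)\<close> is the total mass of \<open>\<mu>\<close>.
\<close>
lemma minimum_eq_variance_diff:
  "(\<integral>u. gain u / (1 + gain u) \<partial>\<mu>)
     = (\<integral>x. (cmod (B 0 x))\<^sup>2 \<partial>M) - (\<integral>u. 1 / (1 + gain u) \<partial>\<mu>)"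
proof -
  have "has_stoch_integral M \<mu> W (\<lambda>u. 1) (B 0)"
    using B_rep[OF zero_in] by (simp add: harmonic_zero)
  then have "(\<integral>x. (cmod (B 0 x))\<^sup>2 \<partial>M) = (\<integral>u. 1 \<partial>\<mu>)"
    unfolding l2norm_power2[symmetric] by (simp add: has_stoch_integral_isometry l2norm_power2)
  also have "\<dots> = (\<integral>u. gain u / (1 + gain u) + 1 / (1 + gain u) \<partial>\<mu>)"
    using add_pos_nonneg[of 1 "gain _"]
    by (intro Bochner_Integration.integral_cong) (simp_all add: field_simps add_nonneg_eq_0_iff)
  also have "\<dots> = (\<integral>u. gain u / (1 + gain u) \<partial>\<mu>) + (\<integral>u. 1 / (1 + gain u) \<partial>\<mu>)"
    by (intro Bochner_Integration.integral_add integrable_gain integrable_optimum)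
  finally show ?thesis by simp
qed

end

theorem theorem3p1:
  fixes M :: "'a measure" and \<Theta> :: "real set" and B :: "real \<Rightarrow> 'a \<Rightarrow> complex"
    and \<mu> :: "real measure" and W :: "real set \<Rightarrow> 'a \<Rightarrow> complex" and ell :: "real \<Rightarrow> complex"
  assumes "prob_space M"
    and "\<Theta> = \<int> \<or> \<Theta> = UNIV"
    and "wide_sense_stationary M \<Theta> B"
    and "\<Theta> = UNIV \<Longrightarrow> mean_square_continuous M B"
    and "spectral_measure M \<Theta> B \<mu>"
    and "spectral_random_measure M \<Theta> B \<mu> W"
    and "ell \<in> borel_measurable (restrict_space borel (freq_domain \<Theta>))"
  shows
    "let H = closed_span M \<Theta> B;
         D = filter_domain M \<Theta> B \<mu> W ell;
         L = linear_filter M \<mu> W ell;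
         J = (\<lambda>Y. (\<integral>x. (cmod (Y x - B 0 x))\<^sup>2 \<partial>M) + (\<integral>x. (cmod (L Y x))\<^sup>2 \<partial>M));
         \<phi> = (\<lambda>u. complex_of_real (1 / (1 + (cmod (ell u))\<^sup>2)));
         \<xi> = stoch_integral M \<mu> W \<phi>
     in has_stoch_integral M \<mu> W \<phi> \<xi> \<and>
        is_arg_min J (\<lambda>Y. Y \<in> H \<inter> D) \<xi> \<and>
        (\<forall>Y. is_arg_min J (\<lambda>Y. Y \<in> H \<inter> D) Y \<longrightarrow> (AE x in M. Y x = \<xi> x)) \<and>
        J \<xi> = (\<integral>u. (cmod (ell u))\<^sup>2 / (1 + (cmod (ell u))\<^sup>2) \<partial>\<mu>) \<and>
        J \<xi> = (\<integral>x. (cmod (B 0 x))\<^sup>2 \<partial>M) - (\<integral>u. 1 / (1 + (cmod (ell u))\<^sup>2) \<partial>\<mu>)"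
proof -
  have finM: "finite_measure M"
    using assms(1) by (simp add: prob_space_def)
  have fin\<mu>: "finite_measure \<mu>" and sets\<mu>: "sets \<mu> = sets (restrict_space borel (freq_domain \<Theta>))"
    using assms(5) by (simp_all add: spectral_measure_def)
  have "(1 / 2 :: real) \<notin> \<int>"
    using Ints_nonzero_abs_ge1[of "1 / 2 :: real"] by auto
  then have "(UNIV :: real set) \<noteq> \<int>" by blast
  then have dense: "closed_span \<mu> \<Theta> harmonic = square_integrable \<mu>"
    using assms(2) harmonics_dense_Ints[OF fin\<mu>] harmonics_dense_UNIV[OF fin\<mu>] sets\<mu>
    unfolding freq_domain_def by metis
  interpret filtered_process M \<mu> W \<Theta> B ell
  proof (intro filtered_process.intro orthogonal_measure.intro filtered_process_axioms.intro)
    show "has_stoch_integral M \<mu> W (harmonic t) (B t)" if "t \<in> \<Theta>" for t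
      using assms(6) that by (simp add: spectral_random_measure_def harmonic_def[abs_def])
    show "ell \<in> borel_measurable \<mu>"
      using assms(7) measurable_cong_sets[OF sets\<mu> refl] by blast
    show "orthogonal_random_measure M \<mu> W"
      using assms(6) by (simp add: spectral_random_measure_def)
    show "0 \<in> \<Theta>"
      using assms(2) by auto
  qed (fact finM fin\<mu> dense)+
  have dom: "closed_span M \<Theta> B \<inter> filter_domain M \<Theta> B \<mu> W ell = filter_domain M \<Theta> B \<mu> W ell"
    by (auto simp: filter_domain_def)
  show ?thesis
    unfolding Let_def dom best_estimate_def[symmetric]
  proof (intro conjI allI impI)
    show "has_stoch_integral M \<mu> W optimum best_estimate"
      by (rule best_estimate_rep)
    show "is_arg_min objective (\<lambda>Y. Y \<in> filter_domain M \<Theta> B \<mu> W ell) best_estimate"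
      using best_estimate_in_domain objective_best_estimate_le by (auto simp: is_arg_min_def not_less)
    fix Y assume "is_arg_min objective (\<lambda>Y. Y \<in> filter_domain M \<Theta> B \<mu> W ell) Y"
    then show "AE x in M. Y x = best_estimate x"
      using best_estimate_in_domain by (intro minimizer_unique) (auto simp: is_arg_min_def not_less)
  next
    show "objective best_estimate = (\<integral>u. gain u / (1 + gain u) \<partial>\<mu>)"
      by (rule objective_best_estimate)
    show "objective best_estimate = (\<integral>x. (cmod (B 0 x))\<^sup>2 \<partial>M) - (\<integral>u. 1 / (1 + gain u) \<partial>\<mu>)"
      unfolding objective_best_estimate by (rule minimum_eq_variance_diff)
  qed
qed

end
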